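(* Let $X$ be a locally path connected space and $x_0\in X$. A subgroup $H$ of the fundamental group $\pi_1(X,x_0)$ is a semicovering subgroup if and only if $H$ is open in $\pi_1^{\mathrm{pSpan}}(X,x_0)$.
   Context: A semicovering map $p:\widetilde X\to X$ is a continuous surjective local homeomorphism with the unique path lifting property: for every path $f:[0,1]\to X$ and every $\tilde x\in p^{-1}(f(0))$ there is exactly one path $\tilde f:[0,1]\to\widetilde X$ with $\tilde f(0)=\tilde x$ and $p\circ\tilde f=f$. A subgroup $H\leq\pi_1(X,x_0)$ is a semicovering subgroup if there is a semicovering map $p:(\widetilde X,\tilde x_0)\to(X,x_0)$ with $H=p_*\pi_1(\widetilde X,\tilde x_0)$. Let $P(X,x_0)$ be the set of paths in $X$ starting at $x_0$. A path open cover is a family $\mathcal V=\{V_\alpha\mid\alpha\in P(X,x_0)\}$ of open subsets of $X$ with $\alpha(1)\in V_\alpha$. The path Spanier subgroup $\widetilde\pi(\mathcal V,x_0)$ is the subgroup of $\pi_1(X,x_0)$ consisting of all classes with a representative of the form $\prod_{j=1}^n\alpha_j*\beta_j*\alpha_j^{-1}$, where $\alpha_j\in P(X,x_0)$ and $\beta_j$ is a loop based at $\alpha_j(1)$ lying in $V_{\alpha_j}$. The space $\pi_1^{\mathrm{pSpan}}(X,x_0)$ is $\pi_1(X,x_0)$ with the topology having as a basis all left cosets $g\,\widetilde\pi(\mathcal V,x_0)$, where $g\in\pi_1(X,x_0)$ and $\mathcal V$ is a path open cover. *)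

theory Defs
  imports "HOL-Analysis.Analysis" "HOL-Algebra.Coset"
begin

section \<open>The fundamental group of an abstract topological space\<close>

text \<open>The library's \<open>+++\<close>, \<open>reversepath\<close> and \<open>homotopic_paths\<close> need a type of class
  \<open>topological_space\<close>; the total space of a semicovering is an arbitrary \<open>'b topology\<close>, so the
  notions are restated for paths in the sense of \<open>pathin\<close>.\<close>

definition path_join :: "(real \<Rightarrow> 'a) \<Rightarrow> (real \<Rightarrow> 'a) \<Rightarrow> real \<Rightarrow> 'a" (infixr \<open>\<cdot>\<^sub>p\<close> 75)
  where "f \<cdot>\<^sub>p g = (\<lambda>t. if t \<le> 1/2 then f (2 * t) else g (2 * t - 1))"

definition path_rev :: "(real \<Rightarrow> 'a) \<Rightarrow> real \<Rightarrow> 'a"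
  where "path_rev f = (\<lambda>t. f (1 - t))"

definition loops_at :: "'a topology \<Rightarrow> 'a \<Rightarrow> (real \<Rightarrow> 'a) set"
  where "loops_at X x = {f. pathin X f \<and> f 0 = x \<and> f 1 = x}"

definition loop_class :: "'a topology \<Rightarrow> 'a \<Rightarrow> (real \<Rightarrow> 'a) \<Rightarrow> (real \<Rightarrow> 'a) set"
  where "loop_class X x f =
    {g \<in> loops_at X x. homotopic_with (\<lambda>r. r 0 = x \<and> r 1 = x) (top_of_set {0..1}) X f g}"

text \<open>The unions in the multiplication and in the induced map run over all representatives.
  They all contribute the same class, so no choice of representatives is needed.\<close>

definition fundamental_group :: "'a topology \<Rightarrow> 'a \<Rightarrow> (real \<Rightarrow> 'a) set monoid"
  where "fundamental_group X x =
    \<lparr>carrier = loop_class X x ` loops_at X x,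
     mult = (\<lambda>A B. \<Union>f\<in>A. \<Union>g\<in>B. loop_class X x (f \<cdot>\<^sub>p g)),
     one = loop_class X x (\<lambda>_. x)\<rparr>"

definition fundamental_group_map ::
    "'a topology \<Rightarrow> 'a \<Rightarrow> ('b \<Rightarrow> 'a) \<Rightarrow> (real \<Rightarrow> 'b) set \<Rightarrow> (real \<Rightarrow> 'a) set"
  where "fundamental_group_map X x p A = (\<Union>f\<in>A. loop_class X x (p \<circ> f))"


section \<open>Semicoverings\<close>

definition local_homeomorphism :: "'b topology \<Rightarrow> 'a topology \<Rightarrow> ('b \<Rightarrow> 'a) \<Rightarrow> bool"
  where "local_homeomorphism E X p \<longleftrightarrow>
    (\<forall>e\<in>topspace E. \<exists>U. openin E U \<and> e \<in> U \<and> openin X (p ` U) \<and>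
        homeomorphic_map (subtopology E U) (subtopology X (p ` U)) p)"

text \<open>A path is represented by a function on all of \<open>real\<close>, of which only the values on
  \<open>{0..1}\<close> matter. Membership in \<open>extensional {0..1}\<close> normalises the other values, so that
  equality of functions is equality of paths.\<close>

definition unique_path_lifting :: "'b topology \<Rightarrow> 'a topology \<Rightarrow> ('b \<Rightarrow> 'a) \<Rightarrow> bool"
  where "unique_path_lifting E X p \<longleftrightarrow>
    (\<forall>f e. pathin X f \<and> e \<in> topspace E \<and> p e = f 0 \<longrightarrow>
      (\<exists>!g. g \<in> extensional {0..1} \<and> pathin E g \<and> g 0 = e \<and> (\<forall>t\<in>{0..1}. p (g t) = f t)))"

definition semicovering_map :: "'b topology \<Rightarrow> 'a topology \<Rightarrow> ('b \<Rightarrow> 'a) \<Rightarrow> bool"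
  where "semicovering_map E X p \<longleftrightarrow>
    continuous_map E X p \<and> p ` topspace E = topspace X \<and>
    local_homeomorphism E X p \<and> unique_path_lifting E X p"

text \<open>HOL cannot quantify existentially over types, so the type of the points of the total
  space is a parameter. The type \<open>(real \<Rightarrow> 'a) set\<close> is large enough for every semicovering
  subgroup of a locally path connected space: the points of the semicovering built from \<open>H\<close> are
  sets of paths in \<open>X\<close>, namely classes modulo \<open>H\<close>.\<close>

definition semicovering_subgroup ::
    "'b itself \<Rightarrow> 'a topology \<Rightarrow> 'a \<Rightarrow> (real \<Rightarrow> 'a) set set \<Rightarrow> bool"
  where "semicovering_subgroup (_ :: 'b itself) X x H \<longleftrightarrow>
    (\<exists>(E :: 'b topology) p e. semicovering_map E X p \<and> e \<in> topspace E \<and> p e = x \<and>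
        H = fundamental_group_map X x p ` carrier (fundamental_group E e))"


section \<open>The path Spanier topology\<close>

text \<open>Paths index the members of a path open cover, hence the normalisation by
  \<open>extensional {0..1}\<close>: each path must have exactly one \<open>V \<alpha>\<close>.\<close>

definition paths_from :: "'a topology \<Rightarrow> 'a \<Rightarrow> (real \<Rightarrow> 'a) set"
  where "paths_from X x = {\<alpha> \<in> extensional {0..1}. pathin X \<alpha> \<and> \<alpha> 0 = x}"

definition path_open_cover :: "'a topology \<Rightarrow> 'a \<Rightarrow> ((real \<Rightarrow> 'a) \<Rightarrow> 'a set) \<Rightarrow> bool"
  where "path_open_cover X x V \<longleftrightarrow> (\<forall>\<alpha>\<in>paths_from X x. openin X (V \<alpha>) \<and> \<alpha> 1 \<in> V \<alpha>)"

text \<open>The constant loop that ends the fold does not change the homotopy class.\<close>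

definition path_spanier_subgroup ::
    "'a topology \<Rightarrow> 'a \<Rightarrow> ((real \<Rightarrow> 'a) \<Rightarrow> 'a set) \<Rightarrow> (real \<Rightarrow> 'a) set set"
  where "path_spanier_subgroup X x V =
    {loop_class X x (foldr (\<cdot>\<^sub>p) (map (\<lambda>(\<alpha>, \<beta>). \<alpha> \<cdot>\<^sub>p \<beta> \<cdot>\<^sub>p path_rev \<alpha>) ps) (\<lambda>_. x)) | ps.
      \<forall>(\<alpha>, \<beta>)\<in>set ps. \<alpha> \<in> paths_from X x \<and> \<beta> \<in> loops_at X (\<alpha> 1) \<and> \<beta> ` {0..1} \<subseteq> V \<alpha>}"

text \<open>The open sets are the unions of left cosets. The cosets do form a basis, because
  \<open>path_spanier_subgroup X x (\<lambda>\<alpha>. V \<alpha> \<inter> W \<alpha>)\<close> is contained in the path Spanier subgroups of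
  both \<open>V\<close> and \<open>W\<close>.\<close>

definition pspan_topology :: "'a topology \<Rightarrow> 'a \<Rightarrow> (real \<Rightarrow> 'a) set topology"
  where "pspan_topology X x = topology (arbitrary union_of
    (\<lambda>S. \<exists>g V. g \<in> carrier (fundamental_group X x) \<and> path_open_cover X x V \<and>
        S = g <#\<^bsub>fundamental_group X x\<^esub> path_spanier_subgroup X x V))"

end

theory Submission
  imports Defs
begin

text \<open>Suppose first that \<open>p\<close> is a semicovering of \<open>X\<close> with base point \<open>e\<close> over \<open>x\<close>. A path \<open>\<alpha>\<close> from \<open>x\<close>
has a lift from \<open>e\<close>; near the end of the lift \<open>p\<close> is a homeomorphism onto an open set, and this set is
taken as \<open>V \<alpha>\<close>. A loop \<open>\<beta>\<close> in \<open>V \<alpha>\<close> then lifts, through the local inverse of \<open>p\<close>, to a loop at the end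
of the lift of \<open>\<alpha>\<close>, and therefore the conjugate \<open>\<alpha> * \<beta> * \<alpha>\<inverse>\<close> lifts to a loop at \<open>e\<close>. So the path
Spanier subgroup of \<open>V\<close> lies in the image of \<open>p\<close> (\<open>small_conjugates_lift\<close>), and a subgroup that contains
a path Spanier subgroup is a union of its cosets, hence open (\<open>openin_pspan_topology_subgroup_iff\<close>). Here a
loop class belongs to the image as soon as one of its representatives lifts to a loop.

Conversely, an open subgroup \<open>H\<close> contains the path Spanier subgroup of some \<open>V\<close>. The semicovering is the
space of path classes modulo \<open>H\<close>, with the endpoint as projection, where a neighbourhood of the class of
\<open>\<alpha>\<close> consists of the classes of the paths \<open>\<alpha> * \<gamma>\<close>, for \<open>\<gamma>\<close> in a neighbourhood \<open>U\<close> of \<open>\<alpha> 1\<close>. If \<open>U\<close> is path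
connected and lies in \<open>V \<alpha>\<close>, then each point of \<open>U\<close> is the endpoint of exactly one such class, because two
paths \<open>\<gamma>\<close>, \<open>\<delta>\<close> in \<open>U\<close> with the same ends differ by a loop in \<open>V \<alpha>\<close>, whose conjugate by \<open>\<alpha>\<close> is in \<open>H\<close>. This
makes the projection a local homeomorphism. The lift of a path \<open>f\<close> sends \<open>t\<close> to the class of \<open>\<alpha>\<close> followed
by \<open>f\<close> restricted to the interval from \<open>0\<close> to \<open>t\<close>; any other lift agrees with this formula locally, hence
everywhere by connectedness of the interval. A loop at \<open>x\<close> lifts to a loop at the class of the constant
path exactly if its class is in \<open>H\<close>.

A semicovering has to be surjective, while paths from \<open>x\<close> only reach one path component of \<open>X\<close>. So the
construction uses paths with arbitrary starting points, and \<open>H\<close> is divided out only for paths that start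
at \<open>x\<close>; for all others the class is given by the two ends. The construction depends on
a few properties of this equivalence relation, which make up the locale \<open>path_congruence\<close>.\<close>

section \<open>Homotopy of paths relative to the endpoints\<close>

text \<open>For loops at \<open>x\<close> this is the relation that defines \<open>loop_class X x\<close>. Paths with different ends are needed
as well, since the points of the semicovering are classes of arbitrary paths.\<close>

definition path_homotopic :: "'a topology \<Rightarrow> (real \<Rightarrow> 'a) \<Rightarrow> (real \<Rightarrow> 'a) \<Rightarrow> bool"
  where "path_homotopic X f g \<longleftrightarrow>
    homotopic_with (\<lambda>r. r 0 = f 0 \<and> r 1 = f 1) (top_of_set {0..1}) X f g"

lemma path_homotopic_imp_pathin:
  assumes "path_homotopic X f g"
  shows "pathin X f" "pathin X g"
  using homotopic_with_imp_continuous_maps[OF assms[unfolded path_homotopic_def]]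
  by (simp_all add: pathin_def)

lemma path_homotopic_imp_ends:
  assumes "path_homotopic X f g"
  shows "g 0 = f 0" "g 1 = f 1"
  using homotopic_with_imp_property[OF assms[unfolded path_homotopic_def]] by auto

lemma path_homotopic_sym: "path_homotopic X f g \<Longrightarrow> path_homotopic X g f"
  using path_homotopic_imp_ends[of X f g]
  by (simp add: path_homotopic_def homotopic_with_symD)

lemma path_homotopic_trans [trans]:
  assumes "path_homotopic X f g" "path_homotopic X g h"
  shows "path_homotopic X f h"
proof -
  have "homotopic_with (\<lambda>r. r 0 = f 0 \<and> r 1 = f 1) (top_of_set {0..1}) X g h"
    using assms(2) path_homotopic_imp_ends[OF assms(1)] by (simp add: path_homotopic_def)
  with assms(1) show ?thesis
    unfolding path_homotopic_def by (rule homotopic_with_trans)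
qed

lemma path_homotopic_eq_on:
  assumes "pathin X f" "\<And>t. t \<in> {0..1} \<Longrightarrow> f t = g t"
  shows "path_homotopic X f g"
  using assms unfolding path_homotopic_def pathin_def
  by (intro homotopic_with_equal) auto

lemma path_homotopic_refl: "pathin X f \<Longrightarrow> path_homotopic X f f"
  by (rule path_homotopic_eq_on) auto

lemma path_homotopic_compose:
  assumes "path_homotopic E f g" "continuous_map E X p"
  shows "path_homotopic X (p \<circ> f) (p \<circ> g)"
  using assms unfolding path_homotopic_def
  by (elim homotopic_with_compose_continuous_map_left) auto

lemma pathin_eq_on:
  assumes "pathin X f" "\<And>t. t \<in> {0..1} \<Longrightarrow> f t = g t"
  shows "pathin X g"
  by (rule path_homotopic_imp_pathin(2)[OF path_homotopic_eq_on[OF assms]])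

lemma pathin_in_topspace: "pathin X f \<Longrightarrow> t \<in> {0..1} \<Longrightarrow> f t \<in> topspace X"
  by (auto simp: pathin_def continuous_map_def)

lemma pathin_reparam:
  assumes "pathin X f" "continuous_on {0..1} \<phi>" "\<phi> ` {0..1} \<subseteq> {0..1}"
  shows "pathin X (\<lambda>t. f (\<phi> t))"
  using assms continuous_map_compose[of "top_of_set {0..1}" "top_of_set {0..1}" \<phi> X f]
  by (auto simp: pathin_def o_def)

text \<open>A straight line deforms \<open>\<phi>\<close> into \<open>\<psi>\<close> within the interval. All the groupoid laws below are instances: each
exhibits both sides as reparametrisations of a single path.\<close>

lemma path_homotopic_reparam:
  assumes f: "pathin X f"
    and \<phi>: "continuous_on {0..1} \<phi>" "\<phi> ` {0..1} \<subseteq> {0..1}"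
    and \<psi>: "continuous_on {0..1} \<psi>" "\<psi> ` {0..1} \<subseteq> {0..1}"
    and ends: "\<phi> 0 = \<psi> 0" "\<phi> 1 = \<psi> 1"
  shows "path_homotopic X (\<lambda>t. f (\<phi> t)) (\<lambda>t. f (\<psi> t))"
  unfolding path_homotopic_def homotopic_with_def
proof (intro exI conjI allI ballI)
  let ?k = "\<lambda>(s, t). (1 - s) * \<phi> t + s * \<psi> t"
  have c1: "continuous_on ({0..1} \<times> {0..1}) (\<lambda>x::real \<times> real. \<phi> (snd x))"
    by (rule continuous_on_compose2[OF \<phi>(1) continuous_on_snd[OF continuous_on_id]]) auto
  have c2: "continuous_on ({0..1} \<times> {0..1}) (\<lambda>x::real \<times> real. \<psi> (snd x))"
    by (rule continuous_on_compose2[OF \<psi>(1) continuous_on_snd[OF continuous_on_id]]) auto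
  have "continuous_on ({0..1} \<times> {0..1}) ?k"
    unfolding case_prod_unfold by (intro continuous_intros c1 c2)
  moreover have "?k ` ({0..1} \<times> {0..1}) \<subseteq> {0..1}"
  proof clarify
    fix s t :: real assume s: "s \<in> {0..1}" and t: "t \<in> {0..1}"
    have "\<phi> t \<in> {0..1}" "\<psi> t \<in> {0..1}" using \<phi>(2) \<psi>(2) t by blast+
    then have "(1 - s) *\<^sub>R \<phi> t + s *\<^sub>R \<psi> t \<in> {0..1}"
      using s by (intro convexD[OF convex_real_interval(5)]) auto
    then show "(1 - s) * \<phi> t + s * \<psi> t \<in> {0..1}" by simp
  qed
  ultimately have "continuous_map (prod_topology (top_of_set {0..1}) (top_of_set {0..1}))
      (top_of_set {0..1}) ?k"
    by (auto simp: continuous_map_in_subtopology simp flip: subtopology_Times euclidean_product_topology)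
  then show "continuous_map (prod_topology (top_of_set {0..1}) (top_of_set {0..1})) X (f \<circ> ?k)"
    using f unfolding pathin_def by (rule continuous_map_compose)
qed (use ends in \<open>auto simp: algebra_simps\<close>)

text \<open>Gluing along the second coordinate, for a space \<open>Y\<close> of parameters; with \<open>Y\<close> the interval this joins two
homotopies.\<close>

lemma continuous_map_join:
  fixes X :: "'a topology" and Y :: "'c topology"
  defines "D \<equiv> prod_topology Y (top_of_set {0..1::real})"
  assumes h: "continuous_map D X h" and k: "continuous_map D X k"
    and eq: "\<And>s. s \<in> topspace Y \<Longrightarrow> h (s, 1) = k (s, 0)"
  shows "continuous_map D X (\<lambda>x. if snd x \<le> 1/2 then h (fst x, 2 * snd x) else k (fst x, 2 * snd x - 1))"
proof (rule continuous_map_cases_le)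
  have sndD: "continuous_map D euclideanreal snd"
    unfolding D_def using continuous_map_into_fulltopology[OF continuous_map_snd] .
  then show "continuous_map D euclideanreal snd" .
  show "continuous_map D euclideanreal (\<lambda>x. 1/2)" by simp
  have fstD: "continuous_map D Y fst" unfolding D_def by (rule continuous_map_fst)
  let ?A = "{x \<in> topspace D. snd x \<le> 1/2}" and ?B = "{x \<in> topspace D. 1/2 \<le> snd x}"
  have "continuous_map (subtopology D ?A) (prod_topology Y (top_of_set {0..1})) (\<lambda>x. (fst x, 2 * snd x))"
    by (intro continuous_map_pairedI continuous_map_from_subtopology[OF fstD] continuous_map_into_subtopology
        continuous_map_real_mult continuous_map_from_subtopology[OF sndD]) (auto simp: D_def)
  then have "continuous_map (subtopology D ?A) D (\<lambda>x. (fst x, 2 * snd x))" by (simp only: D_def)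
  from continuous_map_compose[OF this h]
  show "continuous_map (subtopology D ?A) X (\<lambda>x. h (fst x, 2 * snd x))" by (simp add: o_def)
  have "continuous_map (subtopology D ?B) (prod_topology Y (top_of_set {0..1})) (\<lambda>x. (fst x, 2 * snd x - 1))"
    by (intro continuous_map_pairedI continuous_map_from_subtopology[OF fstD] continuous_map_into_subtopology
        continuous_map_real_mult continuous_map_diff continuous_map_from_subtopology[OF sndD]) (auto simp: D_def)
  then have "continuous_map (subtopology D ?B) D (\<lambda>x. (fst x, 2 * snd x - 1))" by (simp only: D_def)
  from continuous_map_compose[OF this k]
  show "continuous_map (subtopology D ?B) X (\<lambda>x. k (fst x, 2 * snd x - 1))" by (simp add: o_def)
  show "h (fst x, 2 * snd x) = k (fst x, 2 * snd x - 1)" if "x \<in> topspace D" "snd x = 1/2" for x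
  proof -
    have "2 * snd x = 1" "2 * snd x - 1 = 0" using that by simp_all
    then show ?thesis using that eq[of "fst x"] by (simp only: D_def) (simp add: mem_Times_iff)
  qed
qed

lemma path_homotopic_join:
  fixes X :: "'a topology"
  assumes f: "path_homotopic X f f'" and g: "path_homotopic X g g'" and fg: "f 1 = g 0"
  shows "path_homotopic X (f \<cdot>\<^sub>p g) (f' \<cdot>\<^sub>p g')"
proof -
  obtain h :: "real \<times> real \<Rightarrow> 'a" where h: "continuous_map (prod_topology (top_of_set {0..1}) (top_of_set {0..1})) X h"
    "\<And>t. h (0, t) = f t" "\<And>t. h (1, t) = f' t" "\<And>s. s \<in> {0..1} \<Longrightarrow> h (s, 0) = f 0 \<and> h (s, 1) = f 1"
    using f unfolding path_homotopic_def homotopic_with_def by blast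
  obtain k :: "real \<times> real \<Rightarrow> 'a" where k: "continuous_map (prod_topology (top_of_set {0..1}) (top_of_set {0..1})) X k"
    "\<And>t. k (0, t) = g t" "\<And>t. k (1, t) = g' t" "\<And>s. s \<in> {0..1} \<Longrightarrow> k (s, 0) = g 0 \<and> k (s, 1) = g 1"
    using g unfolding path_homotopic_def homotopic_with_def by blast
  show ?thesis
    unfolding path_homotopic_def homotopic_with_def
  proof (intro exI conjI allI ballI)
    let ?H = "\<lambda>x. if snd x \<le> 1/2 then h (fst x, 2 * snd x) else k (fst x, 2 * snd x - 1)"
    show "continuous_map (prod_topology (top_of_set {0..1}) (top_of_set {0..1})) X ?H"
      by (rule continuous_map_join) (use h k fg in auto)
  qed (auto simp: path_join_def h k)
qed

lemma pathin_join:
  assumes "pathin X f" "pathin X g" "f 1 = g 0"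
  shows "pathin X (f \<cdot>\<^sub>p g)"
  using path_homotopic_join[OF path_homotopic_refl path_homotopic_refl] assms
    path_homotopic_imp_pathin by blast

lemma path_join_0 [simp]: "(f \<cdot>\<^sub>p g) 0 = f 0"
  and path_join_1 [simp]: "(f \<cdot>\<^sub>p g) 1 = g 1"
  by (auto simp: path_join_def)

lemma path_rev_0 [simp]: "path_rev f 0 = f 1"
  and path_rev_1 [simp]: "path_rev f 1 = f 0"
  by (auto simp: path_rev_def)

lemma path_rev_rev [simp]: "path_rev (path_rev f) = f"
  by (simp add: path_rev_def)

lemma path_rev_join:
  assumes "f 1 = g 0"
  shows "path_rev (f \<cdot>\<^sub>p g) = path_rev g \<cdot>\<^sub>p path_rev f"
proof
  fix t :: real
  show "path_rev (f \<cdot>\<^sub>p g) t = (path_rev g \<cdot>\<^sub>p path_rev f) t"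
  proof (cases "t = 1/2")
    case True
    then show ?thesis using assms by (simp only: path_rev_def path_join_def) simp
  next
    case False
    then show ?thesis
      by (auto simp: path_rev_def path_join_def algebra_simps)
  qed
qed

lemma path_homotopic_rev:
  assumes "path_homotopic X f g"
  shows "path_homotopic X (path_rev f) (path_rev g)"
proof -
  have "continuous_map (top_of_set {0..1::real}) (top_of_set {0..1}) (\<lambda>t. 1 - t)"
    by (auto simp: intro!: continuous_intros)
  with assms have "homotopic_with (\<lambda>r. r 0 = f 1 \<and> r 1 = f 0) (top_of_set {0..1}) X
      (f \<circ> (\<lambda>t. 1 - t)) (g \<circ> (\<lambda>t. 1 - t))"
    unfolding path_homotopic_def by (rule homotopic_with_compose_continuous_map_right) auto
  then show ?thesis by (simp add: path_homotopic_def path_rev_def o_def)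
qed

lemma pathin_rev: "pathin X f \<Longrightarrow> pathin X (path_rev f)"
  using path_homotopic_rev path_homotopic_refl path_homotopic_imp_pathin by blast

lemma path_homotopic_join_const:
  assumes "pathin X f"
  shows "path_homotopic X (f \<cdot>\<^sub>p (\<lambda>_. f 1)) f"
proof -
  have "path_homotopic X (\<lambda>t. f (min (2 * t) 1)) (\<lambda>t. f t)"
    by (rule path_homotopic_reparam[OF assms]) (auto intro!: continuous_intros)
  moreover have "f \<cdot>\<^sub>p (\<lambda>_. f 1) = (\<lambda>t. f (min (2 * t) 1))"
    by (auto simp: path_join_def min_def fun_eq_iff)
  ultimately show ?thesis by simp
qed

lemma path_homotopic_const_join:
  assumes "pathin X f"
  shows "path_homotopic X ((\<lambda>_. f 0) \<cdot>\<^sub>p f) f"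
proof -
  have "path_homotopic X (\<lambda>t. f (max (2 * t - 1) 0)) (\<lambda>t. f t)"
    by (rule path_homotopic_reparam[OF assms]) (auto intro!: continuous_intros)
  moreover have "(\<lambda>_. f 0) \<cdot>\<^sub>p f = (\<lambda>t. f (max (2 * t - 1) 0))"
    by (auto simp: path_join_def max_def fun_eq_iff)
  ultimately show ?thesis by simp
qed

lemma path_homotopic_join_rev:
  assumes "pathin X f"
  shows "path_homotopic X (f \<cdot>\<^sub>p path_rev f) (\<lambda>_. f 0)"
proof -
  have "path_homotopic X (\<lambda>t. f (min (2 * t) (2 - 2 * t))) (\<lambda>t. f 0)"
    by (rule path_homotopic_reparam[OF assms]) (auto intro!: continuous_intros)
  moreover have "f \<cdot>\<^sub>p path_rev f = (\<lambda>t. f (min (2 * t) (2 - 2 * t)))"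
    by (auto simp: path_join_def path_rev_def min_def fun_eq_iff)
  ultimately show ?thesis by simp
qed

lemma path_homotopic_rev_join:
  assumes "pathin X f"
  shows "path_homotopic X (path_rev f \<cdot>\<^sub>p f) (\<lambda>_. f 1)"
  using path_homotopic_join_rev[OF pathin_rev[OF assms]] by simp

lemma path_homotopic_assoc:
  assumes "pathin X f" "pathin X g" "pathin X h" "f 1 = g 0" "g 1 = h 0"
  shows "path_homotopic X ((f \<cdot>\<^sub>p g) \<cdot>\<^sub>p h) (f \<cdot>\<^sub>p (g \<cdot>\<^sub>p h))"
proof -
  \<comment> \<open>The piecewise linear map taking the breakpoints \<open>1/4\<close>, \<open>1/2\<close> of the left side to \<open>1/2\<close>, \<open>3/4\<close>.\<close>
  let ?\<phi> = "\<lambda>t::real. min (2 * t) (min (t + 1/4) ((t + 1) / 2))"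
  have "pathin X (f \<cdot>\<^sub>p (g \<cdot>\<^sub>p h))"
    using assms by (intro pathin_join) auto
  then have "path_homotopic X (\<lambda>t. (f \<cdot>\<^sub>p (g \<cdot>\<^sub>p h)) (?\<phi> t)) (\<lambda>t. (f \<cdot>\<^sub>p (g \<cdot>\<^sub>p h)) t)"
    by (rule path_homotopic_reparam) (auto intro!: continuous_intros simp: min_le_iff_disj)
  moreover have "((f \<cdot>\<^sub>p g) \<cdot>\<^sub>p h) t = (f \<cdot>\<^sub>p (g \<cdot>\<^sub>p h)) (?\<phi> t)" for t
  proof -
    consider "t \<le> 1/4" | "1/4 < t" "t \<le> 1/2" | "1/2 < t" by linarith
    then show ?thesis
    proof cases
      case 1
      then have "?\<phi> t = 2 * t" by (simp add: min_def)
      with 1 show ?thesis by (simp add: path_join_def)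
    next
      case 2
      then have "?\<phi> t = t + 1/4" by (simp add: min_def)
      with 2 show ?thesis by (simp add: path_join_def algebra_simps)
    next
      case 3
      then have "?\<phi> t = (t + 1) / 2" by (simp add: min_def field_simps)
      with 3 show ?thesis by (simp add: path_join_def field_simps)
    qed
  qed
  then have "(f \<cdot>\<^sub>p g) \<cdot>\<^sub>p h = (\<lambda>t. (f \<cdot>\<^sub>p (g \<cdot>\<^sub>p h)) (?\<phi> t))" by blast
  ultimately show ?thesis by simp
qed

text \<open>The path \<open>f\<close> run from time \<open>s\<close> to time \<open>t\<close>, backwards if \<open>t < s\<close>.\<close>

definition path_segment :: "(real \<Rightarrow> 'a) \<Rightarrow> real \<Rightarrow> real \<Rightarrow> real \<Rightarrow> 'a"
  where "path_segment f s t = (\<lambda>u. f (s + (t - s) * u))"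

lemma path_segment_0 [simp]: "path_segment f s t 0 = f s"
  and path_segment_1 [simp]: "path_segment f s t 1 = f t"
  by (auto simp: path_segment_def)

lemma path_segment_self: "path_segment f t t = (\<lambda>_. f t)"
  by (simp add: path_segment_def)

lemma path_segment_full: "path_segment f 0 1 = f"
  by (simp add: path_segment_def)

lemma segment_point_bounds:
  fixes s t u :: real
  assumes "u \<in> {0..1}"
  shows "s + (t - s) * u \<in> {min s t..max s t}"
proof -
  have "(1 - u) *\<^sub>R s + u *\<^sub>R t \<in> {min s t..max s t}"
    using assms by (intro convexD[OF convex_real_interval(5)]) auto
  then show ?thesis by (simp add: algebra_simps)
qed

lemma pathin_segment:
  assumes "pathin X f" "s \<in> {0..1}" "t \<in> {0..1}"
  shows "pathin X (path_segment f s t)"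
  unfolding path_segment_def
proof (rule pathin_reparam[OF assms(1)])
  show "(\<lambda>u. s + (t - s) * u) ` {0..1} \<subseteq> {0..1}"
    using segment_point_bounds[of _ s t] assms by fastforce
qed (intro continuous_intros)

lemma path_homotopic_segments:
  assumes f: "pathin X f" and s: "s \<in> {0..1}" and t: "t \<in> {0..1}" and u: "u \<in> {0..1}"
  shows "path_homotopic X (path_segment f s t \<cdot>\<^sub>p path_segment f t u) (path_segment f s u)"
proof -
  \<comment> \<open>\<open>?\<phi>\<close> runs from \<open>s\<close> to \<open>t\<close> in the first half and from \<open>t\<close> to \<open>u\<close> in the second half.\<close>
  let ?\<phi> = "\<lambda>v. s + (t - s) * min (2 * v) 1 + (u - t) * max (2 * v - 1) 0"
  have "path_homotopic X (\<lambda>v. f (?\<phi> v)) (\<lambda>v. f (s + (u - s) * v))"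
  proof (rule path_homotopic_reparam[OF f])
    show "?\<phi> ` {0..1} \<subseteq> {0..1}"
    proof clarify
      fix v :: real assume v: "v \<in> {0..1}"
      show "?\<phi> v \<in> {0..1}"
      proof (cases "v \<le> 1/2")
        case True
        then show ?thesis using v segment_point_bounds[of "2 * v" s t] s t by auto
      next
        case False
        then show ?thesis using v segment_point_bounds[of "2 * v - 1" t u] t u by auto
      qed
    qed
    show "(\<lambda>v. s + (u - s) * v) ` {0..1} \<subseteq> {0..1}"
      using segment_point_bounds[of _ s u] s u by fastforce
  qed (intro continuous_intros | simp)+
  moreover have "path_segment f s t \<cdot>\<^sub>p path_segment f t u = (\<lambda>v. f (?\<phi> v))"
    by (rule ext) (simp add: path_segment_def path_join_def)
  ultimately show ?thesis by (simp add: path_segment_def)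
qed

text \<open>Used to move from one path \<open>g\<close> in a small set to another one, \<open>h\<close>, by means of the loop formed by both.\<close>

lemma path_homotopic_join_rev_cancel:
  assumes f: "pathin X f" and g: "pathin X g" and h: "pathin X h" and fg: "f 1 = g 0" and gh: "g 1 = h 1"
  shows "path_homotopic X (f \<cdot>\<^sub>p g) ((f \<cdot>\<^sub>p (g \<cdot>\<^sub>p path_rev h)) \<cdot>\<^sub>p h)"
proof -
  have rh: "pathin X (path_rev h)" using h by (rule pathin_rev)
  have grh: "pathin X (g \<cdot>\<^sub>p path_rev h)" using g rh gh by (simp add: pathin_join)
  have "path_homotopic X ((f \<cdot>\<^sub>p (g \<cdot>\<^sub>p path_rev h)) \<cdot>\<^sub>p h) (f \<cdot>\<^sub>p ((g \<cdot>\<^sub>p path_rev h) \<cdot>\<^sub>p h))"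
    using f grh h fg by (intro path_homotopic_assoc) simp_all
  also have "path_homotopic X \<dots> (f \<cdot>\<^sub>p g)"
  proof (rule path_homotopic_join[OF path_homotopic_refl[OF f]])
    have "path_homotopic X ((g \<cdot>\<^sub>p path_rev h) \<cdot>\<^sub>p h) (g \<cdot>\<^sub>p (path_rev h \<cdot>\<^sub>p h))"
      using g rh h gh by (intro path_homotopic_assoc) simp_all
    also have "path_homotopic X \<dots> (g \<cdot>\<^sub>p (\<lambda>_. h 1))"
      using path_homotopic_join[OF path_homotopic_refl[OF g] path_homotopic_rev_join[OF h]] gh by simp
    also have "path_homotopic X \<dots> g"
      using path_homotopic_join_const[OF g] gh by simp
    finally show "path_homotopic X ((g \<cdot>\<^sub>p path_rev h) \<cdot>\<^sub>p h) g" .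
  qed (use fg in simp)
  finally show ?thesis by (rule path_homotopic_sym)
qed

lemma path_homotopic_join_rev_join:
  assumes \<alpha>: "pathin X \<alpha>" and \<beta>: "pathin X \<beta>" and \<gamma>: "pathin X \<gamma>" and "\<alpha> 1 = \<beta> 1" "\<beta> 1 = \<gamma> 0"
  shows "path_homotopic X ((\<alpha> \<cdot>\<^sub>p \<gamma>) \<cdot>\<^sub>p path_rev (\<beta> \<cdot>\<^sub>p \<gamma>)) (\<alpha> \<cdot>\<^sub>p path_rev \<beta>)"
proof -
  note ends = assms(4,5)
  note rev = pathin_rev[OF \<beta>] pathin_rev[OF \<gamma>]
  have "path_homotopic X ((\<alpha> \<cdot>\<^sub>p \<gamma>) \<cdot>\<^sub>p (path_rev \<gamma> \<cdot>\<^sub>p path_rev \<beta>)) (\<alpha> \<cdot>\<^sub>p (\<gamma> \<cdot>\<^sub>p (path_rev \<gamma> \<cdot>\<^sub>p path_rev \<beta>)))"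
    using \<alpha> \<gamma> rev ends by (intro path_homotopic_assoc pathin_join) simp_all
  also have "path_homotopic X \<dots> (\<alpha> \<cdot>\<^sub>p path_rev \<beta>)"
  proof (rule path_homotopic_join[OF path_homotopic_refl[OF \<alpha>]])
    have "path_homotopic X ((\<gamma> \<cdot>\<^sub>p path_rev \<gamma>) \<cdot>\<^sub>p path_rev \<beta>) (\<gamma> \<cdot>\<^sub>p (path_rev \<gamma> \<cdot>\<^sub>p path_rev \<beta>))"
      using \<gamma> rev ends by (intro path_homotopic_assoc) simp_all
    then have "path_homotopic X (\<gamma> \<cdot>\<^sub>p (path_rev \<gamma> \<cdot>\<^sub>p path_rev \<beta>)) ((\<gamma> \<cdot>\<^sub>p path_rev \<gamma>) \<cdot>\<^sub>p path_rev \<beta>)"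
      by (rule path_homotopic_sym)
    also have "path_homotopic X \<dots> ((\<lambda>_. \<gamma> 0) \<cdot>\<^sub>p path_rev \<beta>)"
      using ends by (intro path_homotopic_join path_homotopic_join_rev[OF \<gamma>] path_homotopic_refl rev) simp
    also have "path_homotopic X \<dots> (path_rev \<beta>)"
      using path_homotopic_const_join[OF rev(1)] ends by simp
    finally show "path_homotopic X (\<gamma> \<cdot>\<^sub>p (path_rev \<gamma> \<cdot>\<^sub>p path_rev \<beta>)) (path_rev \<beta>)" .
  qed (use ends in simp)
  finally show ?thesis using ends by (simp add: path_rev_join)
qed

section \<open>The fundamental group is a group\<close>

lemma loops_at_join: "f \<in> loops_at X x \<Longrightarrow> g \<in> loops_at X x \<Longrightarrow> f \<cdot>\<^sub>p g \<in> loops_at X x"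
  by (simp add: loops_at_def pathin_join)

lemma loops_at_rev: "f \<in> loops_at X x \<Longrightarrow> path_rev f \<in> loops_at X x"
  by (simp add: loops_at_def pathin_rev)

lemma loops_at_const: "x \<in> topspace X \<Longrightarrow> (\<lambda>_. x) \<in> loops_at X x"
  by (simp add: loops_at_def)

text \<open>Homotopies fix the ends, so a loop class is the full homotopy class of any of its members.\<close>

lemma loops_at_homotopic:
  assumes "f \<in> loops_at X x" "path_homotopic X f g"
  shows "g \<in> loops_at X x"
  using assms path_homotopic_imp_pathin(2)[OF assms(2)] path_homotopic_imp_ends[OF assms(2)]
  by (simp add: loops_at_def)

lemma loop_class_eq_path_homotopic:
  assumes "f \<in> loops_at X x"
  shows "loop_class X x f = {g. path_homotopic X f g}"
proof -
  have "loop_class X x f = {g \<in> loops_at X x. path_homotopic X f g}"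
    using assms by (simp add: loop_class_def path_homotopic_def loops_at_def)
  then show ?thesis using loops_at_homotopic[OF assms] by blast
qed

lemma loop_class_eqI: "f \<in> loops_at X x \<Longrightarrow> path_homotopic X f g \<Longrightarrow> loop_class X x f = loop_class X x g"
  using loops_at_homotopic[of f X x g]
  by (auto simp: loop_class_eq_path_homotopic intro: path_homotopic_trans path_homotopic_sym)

lemma loop_class_mem: "f \<in> loops_at X x \<Longrightarrow> f \<in> loop_class X x f"
  by (simp add: loop_class_eq_path_homotopic path_homotopic_refl loops_at_def)

lemma mult_loop_class:
  assumes f: "f \<in> loops_at X x" and g: "g \<in> loops_at X x"
  shows "loop_class X x f \<otimes>\<^bsub>fundamental_group X x\<^esub> loop_class X x g = loop_class X x (f \<cdot>\<^sub>p g)"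
proof -
  have "loop_class X x (f' \<cdot>\<^sub>p g') = loop_class X x (f \<cdot>\<^sub>p g)"
    if "f' \<in> loop_class X x f" "g' \<in> loop_class X x g" for f' g'
  proof (rule loop_class_eqI[symmetric, OF loops_at_join[OF f g]])
    show "path_homotopic X (f \<cdot>\<^sub>p g) (f' \<cdot>\<^sub>p g')"
      using that f g by (intro path_homotopic_join) (auto simp: loop_class_eq_path_homotopic, simp add: loops_at_def)
  qed
  then have "(\<Union>f'\<in>loop_class X x f. \<Union>g'\<in>loop_class X x g. loop_class X x (f' \<cdot>\<^sub>p g')) =
      (\<Union>f'\<in>loop_class X x f. \<Union>g'\<in>loop_class X x g. loop_class X x (f \<cdot>\<^sub>p g))"
    by simp
  moreover have "loop_class X x f \<noteq> {}" "loop_class X x g \<noteq> {}"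
    using loop_class_mem[OF f] loop_class_mem[OF g] by blast+
  ultimately show ?thesis by (simp add: fundamental_group_def)
qed

lemma carrier_fundamental_group: "carrier (fundamental_group X x) = loop_class X x ` loops_at X x"
  by (simp add: fundamental_group_def)

lemma one_fundamental_group: "\<one>\<^bsub>fundamental_group X x\<^esub> = loop_class X x (\<lambda>_. x)"
  by (simp add: fundamental_group_def)

lemma loop_class_closed [simp]: "f \<in> loops_at X x \<Longrightarrow> loop_class X x f \<in> carrier (fundamental_group X x)"
  by (simp add: carrier_fundamental_group)

lemma loop_class_inverse:
  assumes "f \<in> loops_at X x"
  shows "loop_class X x (path_rev f) \<otimes>\<^bsub>fundamental_group X x\<^esub> loop_class X x f =
    \<one>\<^bsub>fundamental_group X x\<^esub>"
proof -
  have "path_homotopic X (path_rev f \<cdot>\<^sub>p f) (\<lambda>_. x)"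
    using path_homotopic_rev_join[of X f] assms by (simp add: loops_at_def)
  then show ?thesis
    using assms by (simp add: mult_loop_class loops_at_rev loops_at_join one_fundamental_group loop_class_eqI)
qed

lemma fundamental_group_is_group:
  assumes x: "x \<in> topspace X"
  shows "group (fundamental_group X x)"
proof (rule groupI)
  let ?G = "fundamental_group X x"
  note [simp] = carrier_fundamental_group one_fundamental_group
  show "\<one>\<^bsub>?G\<^esub> \<in> carrier ?G"
    using loops_at_const[OF x] by simp
  show "a \<otimes>\<^bsub>?G\<^esub> b \<in> carrier ?G" if "a \<in> carrier ?G" "b \<in> carrier ?G" for a b
    using that by (auto simp: mult_loop_class loops_at_join)
  show "(a \<otimes>\<^bsub>?G\<^esub> b) \<otimes>\<^bsub>?G\<^esub> c = a \<otimes>\<^bsub>?G\<^esub> (b \<otimes>\<^bsub>?G\<^esub> c)"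
    if abc: "a \<in> carrier ?G" "b \<in> carrier ?G" "c \<in> carrier ?G" for a b c
  proof -
    obtain f g h where f: "f \<in> loops_at X x" "a = loop_class X x f"
      and g: "g \<in> loops_at X x" "b = loop_class X x g" and h: "h \<in> loops_at X x" "c = loop_class X x h"
      using abc by auto
    have "path_homotopic X ((f \<cdot>\<^sub>p g) \<cdot>\<^sub>p h) (f \<cdot>\<^sub>p (g \<cdot>\<^sub>p h))"
      using f g h by (intro path_homotopic_assoc) (auto simp: loops_at_def)
    then show ?thesis
      using f g h by (simp add: mult_loop_class loops_at_join loop_class_eqI)
  qed
  show "\<one>\<^bsub>?G\<^esub> \<otimes>\<^bsub>?G\<^esub> a = a" if a: "a \<in> carrier ?G" for a
  proof -
    obtain f where f: "f \<in> loops_at X x" "a = loop_class X x f" using a by auto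
    have "path_homotopic X ((\<lambda>_. x) \<cdot>\<^sub>p f) f"
      using path_homotopic_const_join[of X f] f by (simp add: loops_at_def)
    then show ?thesis
      using f loops_at_const[OF x] by (simp add: mult_loop_class loops_at_join loop_class_eqI)
  qed
  show "\<exists>b\<in>carrier ?G. b \<otimes>\<^bsub>?G\<^esub> a = \<one>\<^bsub>?G\<^esub>" if a: "a \<in> carrier ?G" for a
  proof -
    obtain f where f: "f \<in> loops_at X x" "a = loop_class X x f"
      using a unfolding carrier_fundamental_group by blast
    then have "loop_class X x (path_rev f) \<in> carrier ?G" by (simp only: loop_class_closed loops_at_rev)
    with loop_class_inverse[OF f(1)] f(2) show ?thesis by blast
  qed
qed

lemma inv_loop_class:
  assumes x: "x \<in> topspace X" and f: "f \<in> loops_at X x"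
  shows "inv\<^bsub>fundamental_group X x\<^esub> loop_class X x f = loop_class X x (path_rev f)"
  using group.inv_equality[OF fundamental_group_is_group[OF x] loop_class_inverse[OF f]]
  by (simp add: f loops_at_rev)

section \<open>The path Spanier topology\<close>

definition spanier_pair :: "'a topology \<Rightarrow> 'a \<Rightarrow> ((real \<Rightarrow> 'a) \<Rightarrow> 'a set) \<Rightarrow> (real \<Rightarrow> 'a) \<times> (real \<Rightarrow> 'a) \<Rightarrow> bool"
  where "spanier_pair X x V = (\<lambda>(\<alpha>, \<beta>). \<alpha> \<in> paths_from X x \<and> \<beta> \<in> loops_at X (\<alpha> 1) \<and> \<beta> ` {0..1} \<subseteq> V \<alpha>)"

definition conjugate_loop :: "(real \<Rightarrow> 'a) \<times> (real \<Rightarrow> 'a) \<Rightarrow> real \<Rightarrow> 'a"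
  where "conjugate_loop = (\<lambda>(\<alpha>, \<beta>). \<alpha> \<cdot>\<^sub>p \<beta> \<cdot>\<^sub>p path_rev \<alpha>)"

text \<open>The same set as in its definition, with names for the pairs that index the generators and for the
generators themselves.\<close>

lemma path_spanier_subgroup_alt:
  "path_spanier_subgroup X x V = {loop_class X x (foldr (\<cdot>\<^sub>p) (map conjugate_loop ps) (\<lambda>_. x)) | ps.
     \<forall>q\<in>set ps. spanier_pair X x V q}"
  unfolding path_spanier_subgroup_def spanier_pair_def conjugate_loop_def by simp

lemma conjugate_loop_in_loops:
  "spanier_pair X x V q \<Longrightarrow> conjugate_loop q \<in> loops_at X x"
  by (auto simp: spanier_pair_def conjugate_loop_def paths_from_def loops_at_def intro!: pathin_join pathin_rev)

lemma foldr_join_in_loops: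
  assumes "x \<in> topspace X" "set fs \<subseteq> loops_at X x"
  shows "foldr (\<cdot>\<^sub>p) fs (\<lambda>_. x) \<in> loops_at X x"
  using assms by (induction fs) (auto simp: loops_at_join loops_at_const)

text \<open>The path Spanier subgroup is generated as a monoid by the conjugates of small loops, so properties of
its elements can be proved by adding one generator at a time on the left.\<close>

lemma path_spanier_subgroup_induct [consumes 2, case_names one mult]:
  assumes x: "x \<in> topspace X" and a: "a \<in> path_spanier_subgroup X x V"
    and one: "P \<one>\<^bsub>fundamental_group X x\<^esub>"
    and mult: "\<And>q b. spanier_pair X x V q \<Longrightarrow> b \<in> path_spanier_subgroup X x V \<Longrightarrow> P b \<Longrightarrow>
      P (loop_class X x (conjugate_loop q) \<otimes>\<^bsub>fundamental_group X x\<^esub> b)"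
  shows "P a"
proof -
  have "P (loop_class X x (foldr (\<cdot>\<^sub>p) (map conjugate_loop ps) (\<lambda>_. x)))"
    if "\<forall>q\<in>set ps. spanier_pair X x V q" for ps
    using that
  proof (induction ps)
    case (Cons q ps)
    let ?f = "foldr (\<cdot>\<^sub>p) (map conjugate_loop ps) (\<lambda>_. x)"
    have "?f \<in> loops_at X x"
      using Cons.prems by (intro foldr_join_in_loops[OF x]) (auto intro: conjugate_loop_in_loops)
    moreover have "loop_class X x ?f \<in> path_spanier_subgroup X x V"
      using Cons.prems by (auto simp: path_spanier_subgroup_alt)
    ultimately show ?case
      using Cons mult[of q "loop_class X x ?f"] conjugate_loop_in_loops[of X x V q]
      by (simp add: mult_loop_class)
  qed (simp add: one[unfolded one_fundamental_group])
  with a show ?thesis by (auto simp: path_spanier_subgroup_alt)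
qed

lemma one_in_path_spanier_subgroup: "\<one>\<^bsub>fundamental_group X x\<^esub> \<in> path_spanier_subgroup X x V"
  unfolding path_spanier_subgroup_alt one_fundamental_group by (rule CollectI, rule exI[of _ "[]"]) simp

lemma conjugate_loop_mult_in_path_spanier_subgroup:
  assumes x: "x \<in> topspace X" and q: "spanier_pair X x V q" and b: "b \<in> path_spanier_subgroup X x V"
  shows "loop_class X x (conjugate_loop q) \<otimes>\<^bsub>fundamental_group X x\<^esub> b \<in> path_spanier_subgroup X x V"
proof -
  obtain ps where ps: "\<forall>q\<in>set ps. spanier_pair X x V q"
    and b: "b = loop_class X x (foldr (\<cdot>\<^sub>p) (map conjugate_loop ps) (\<lambda>_. x))"
    using b by (auto simp: path_spanier_subgroup_alt)
  have "foldr (\<cdot>\<^sub>p) (map conjugate_loop ps) (\<lambda>_. x) \<in> loops_at X x"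
    using ps by (intro foldr_join_in_loops[OF x]) (auto intro: conjugate_loop_in_loops)
  then have "loop_class X x (conjugate_loop q) \<otimes>\<^bsub>fundamental_group X x\<^esub> b =
      loop_class X x (foldr (\<cdot>\<^sub>p) (map conjugate_loop (q # ps)) (\<lambda>_. x))"
    using conjugate_loop_in_loops[OF q] by (simp add: b mult_loop_class)
  moreover have "\<forall>r\<in>set (q # ps). spanier_pair X x V r" using ps q by simp
  ultimately show ?thesis unfolding path_spanier_subgroup_alt by blast
qed

lemma conjugate_loop_in_path_spanier_subgroup:
  assumes x: "x \<in> topspace X" and q: "spanier_pair X x V q"
  shows "loop_class X x (conjugate_loop q) \<in> path_spanier_subgroup X x V"
proof -
  interpret group "fundamental_group X x" by (rule fundamental_group_is_group[OF x])
  show ?thesis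
    using conjugate_loop_mult_in_path_spanier_subgroup[OF x q one_in_path_spanier_subgroup]
      conjugate_loop_in_loops[OF q] by simp
qed

lemma path_spanier_subgroup_subset:
  assumes x: "x \<in> topspace X" and H: "subgroup H (fundamental_group X x)"
    and sub: "\<And>q. spanier_pair X x V q \<Longrightarrow> loop_class X x (conjugate_loop q) \<in> H"
  shows "path_spanier_subgroup X x V \<subseteq> H"
proof
  fix a assume "a \<in> path_spanier_subgroup X x V"
  with x show "a \<in> H"
    by (induction rule: path_spanier_subgroup_induct)
      (auto intro: subgroup.one_closed[OF H] subgroup.m_closed[OF H] sub)
qed

text \<open>The inverse of a generator is the generator with the reversed small loop; for this reason products of
generators alone already form a subgroup.\<close>

lemma inverse_conjugate_loop:
  assumes q: "spanier_pair X x V (\<alpha>, \<beta>)"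
  shows "spanier_pair X x V (\<alpha>, path_rev \<beta>)"
    "path_homotopic X (path_rev (conjugate_loop (\<alpha>, \<beta>))) (conjugate_loop (\<alpha>, path_rev \<beta>))"
proof -
  have ab: "pathin X \<alpha>" "pathin X \<beta>" "\<beta> 0 = \<alpha> 1" "\<beta> 1 = \<alpha> 1"
    using q by (auto simp: spanier_pair_def paths_from_def loops_at_def)
  have "path_rev \<beta> ` {0..1} \<subseteq> \<beta> ` {0..1}" by (auto simp: path_rev_def)
  then show "spanier_pair X x V (\<alpha>, path_rev \<beta>)"
    using q by (auto simp: spanier_pair_def intro: loops_at_rev)
  have "path_homotopic X ((\<alpha> \<cdot>\<^sub>p path_rev \<beta>) \<cdot>\<^sub>p path_rev \<alpha>) (\<alpha> \<cdot>\<^sub>p path_rev \<beta> \<cdot>\<^sub>p path_rev \<alpha>)"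
    using ab by (intro path_homotopic_assoc) (auto intro: pathin_rev)
  then show "path_homotopic X (path_rev (conjugate_loop (\<alpha>, \<beta>))) (conjugate_loop (\<alpha>, path_rev \<beta>))"
    using ab by (simp add: conjugate_loop_def path_rev_join)
qed

lemma path_spanier_subgroup_is_subgroup:
  assumes x: "x \<in> topspace X"
  shows "subgroup (path_spanier_subgroup X x V) (fundamental_group X x)"
proof -
  let ?S = "path_spanier_subgroup X x V"
  interpret group "fundamental_group X x" by (rule fundamental_group_is_group[OF x])
  have closed: "a \<in> carrier (fundamental_group X x)" if "a \<in> ?S" for a
    using x that by (induction rule: path_spanier_subgroup_induct) (auto dest: conjugate_loop_in_loops)
  have prod_in: "a \<otimes>\<^bsub>fundamental_group X x\<^esub> b \<in> ?S" if "a \<in> ?S" "b \<in> ?S" for a b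
    using x that(1)
  proof (induction rule: path_spanier_subgroup_induct)
    case one
    then show ?case using that(2) closed by simp
  next
    case (mult q c)
    then show ?case
      using conjugate_loop_mult_in_path_spanier_subgroup[OF x] closed that(2)
      by (simp add: m_assoc conjugate_loop_in_loops)
  qed
  show ?thesis
  proof (rule subgroupI)
    show "?S \<subseteq> carrier (fundamental_group X x)" using closed by blast
    show "?S \<noteq> {}" using one_in_path_spanier_subgroup[of X x V] by blast
    show "a \<otimes>\<^bsub>fundamental_group X x\<^esub> b \<in> ?S" if "a \<in> ?S" "b \<in> ?S" for a b
      using prod_in that .
    show "inv\<^bsub>fundamental_group X x\<^esub> a \<in> ?S" if "a \<in> ?S" for a
      using x that
    proof (induction rule: path_spanier_subgroup_induct)
      case one
      then show ?case by (simp add: one_in_path_spanier_subgroup)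
    next
      case (mult q c)
      obtain \<alpha> \<beta> where q: "q = (\<alpha>, \<beta>)" by force
      have l: "conjugate_loop q \<in> loops_at X x" using conjugate_loop_in_loops mult(1) .
      have "inv\<^bsub>fundamental_group X x\<^esub> loop_class X x (conjugate_loop q) =
          loop_class X x (conjugate_loop (\<alpha>, path_rev \<beta>))"
        using inverse_conjugate_loop(2)[of X x V \<alpha> \<beta>] mult(1) l
        by (simp add: q inv_loop_class[OF x] loop_class_eqI loops_at_rev)
      also have "\<dots> \<in> ?S"
        using inverse_conjugate_loop(1)[of X x V \<alpha> \<beta>] mult(1)
        by (intro conjugate_loop_in_path_spanier_subgroup[OF x]) (simp add: q)
      finally show ?case
        using mult l closed by (simp add: inv_mult_group prod_in)
    qed
  qed
qed

lemma path_spanier_subgroup_mono: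
  assumes x: "x \<in> topspace X" and "\<And>\<alpha>. \<alpha> \<in> paths_from X x \<Longrightarrow> V \<alpha> \<subseteq> W \<alpha>"
  shows "path_spanier_subgroup X x V \<subseteq> path_spanier_subgroup X x W"
proof (rule path_spanier_subgroup_subset[OF x path_spanier_subgroup_is_subgroup[OF x]])
  fix q assume "spanier_pair X x V q"
  then have "spanier_pair X x W q"
    using assms(2) by (cases q) (auto simp: spanier_pair_def)
  then show "loop_class X x (conjugate_loop q) \<in> path_spanier_subgroup X x W"
    by (rule conjugate_loop_in_path_spanier_subgroup[OF x])
qed

definition spanier_coset :: "'a topology \<Rightarrow> 'a \<Rightarrow> (real \<Rightarrow> 'a) set set \<Rightarrow> bool"
  where "spanier_coset X x S \<longleftrightarrow> (\<exists>g V. g \<in> carrier (fundamental_group X x) \<and> path_open_cover X x V \<and>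
    S = g <#\<^bsub>fundamental_group X x\<^esub> path_spanier_subgroup X x V)"

lemma spanier_cosetI:
  "g \<in> carrier (fundamental_group X x) \<Longrightarrow> path_open_cover X x V \<Longrightarrow>
    spanier_coset X x (g <#\<^bsub>fundamental_group X x\<^esub> path_spanier_subgroup X x V)"
  unfolding spanier_coset_def by blast

text \<open>Every point of a coset is a centre of it. With \<open>path_spanier_subgroup_mono\<close> this makes the cosets a base.\<close>

lemma spanier_coset_recentre:
  assumes x: "x \<in> topspace X" and S: "spanier_coset X x S" and k: "k \<in> S"
  obtains V where "k \<in> carrier (fundamental_group X x)" "path_open_cover X x V"
    "S = k <#\<^bsub>fundamental_group X x\<^esub> path_spanier_subgroup X x V"
proof -
  interpret group "fundamental_group X x" by (rule fundamental_group_is_group[OF x])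
  note sg = path_spanier_subgroup_is_subgroup[OF x]
  obtain g V where g: "g \<in> carrier (fundamental_group X x)" and V: "path_open_cover X x V"
    and S: "S = g <#\<^bsub>fundamental_group X x\<^esub> path_spanier_subgroup X x V"
    using S unfolding spanier_coset_def by blast
  show thesis
  proof
    show "k \<in> carrier (fundamental_group X x)"
      by (rule l_coset_carrier[OF k[unfolded S] g sg])
    show "S = k <#\<^bsub>fundamental_group X x\<^esub> path_spanier_subgroup X x V"
      unfolding S by (rule l_repr_independence[OF k[unfolded S] g sg])
  qed (rule V)
qed

lemma mem_own_spanier_coset:
  assumes x: "x \<in> topspace X" and k: "k \<in> carrier (fundamental_group X x)"
  shows "k \<in> k <#\<^bsub>fundamental_group X x\<^esub> path_spanier_subgroup X x V"
proof -
  interpret group "fundamental_group X x" by (rule fundamental_group_is_group[OF x])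
  have "k \<otimes>\<^bsub>fundamental_group X x\<^esub> \<one>\<^bsub>fundamental_group X x\<^esub> \<in>
      k <#\<^bsub>fundamental_group X x\<^esub> path_spanier_subgroup X x V"
    unfolding l_coset_def using one_in_path_spanier_subgroup[of X x V] by blast
  then show ?thesis by (simp add: k)
qed

lemma openin_pspan_topology:
  assumes x: "x \<in> topspace X"
  shows "openin (pspan_topology X x) S \<longleftrightarrow> (\<forall>k\<in>S. \<exists>B. spanier_coset X x B \<and> k \<in> B \<and> B \<subseteq> S)"
proof -
  let ?G = "fundamental_group X x"
  have "\<exists>B. spanier_coset X x B \<and> k \<in> B \<and> B \<subseteq> S \<inter> T"
    if S: "spanier_coset X x S" and T: "spanier_coset X x T" and k: "k \<in> S" "k \<in> T" for S T k
  proof -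
    obtain V where kc: "k \<in> carrier ?G" and V: "path_open_cover X x V"
      and S_eq: "S = k <#\<^bsub>?G\<^esub> path_spanier_subgroup X x V"
      using spanier_coset_recentre[OF x S k(1)] .
    obtain W where W: "path_open_cover X x W" and T_eq: "T = k <#\<^bsub>?G\<^esub> path_spanier_subgroup X x W"
      using spanier_coset_recentre[OF x T k(2)] .
    let ?VW = "\<lambda>\<alpha>. V \<alpha> \<inter> W \<alpha>"
    have "path_open_cover X x ?VW"
      using V W unfolding path_open_cover_def by blast
    moreover have "path_spanier_subgroup X x ?VW \<subseteq> path_spanier_subgroup X x V"
      "path_spanier_subgroup X x ?VW \<subseteq> path_spanier_subgroup X x W"
      by (rule path_spanier_subgroup_mono[OF x]; simp)+
    then have "k <#\<^bsub>?G\<^esub> path_spanier_subgroup X x ?VW \<subseteq> S \<inter> T"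
      unfolding S_eq T_eq l_coset_def by blast
    ultimately show ?thesis
      using spanier_cosetI[OF kc] mem_own_spanier_coset[OF x kc] by blast
  qed
  then have "istopology (arbitrary union_of spanier_coset X x)"
    unfolding istopology_base_eq arbitrary_union_of_alt by simp
  moreover have "pspan_topology X x = topology (arbitrary union_of spanier_coset X x)"
    unfolding pspan_topology_def spanier_coset_def by (rule refl)
  ultimately show ?thesis by (simp add: arbitrary_union_of_alt)
qed

text \<open>An open \<open>H\<close> contains a basic neighbourhood of the neutral element, which is a path Spanier subgroup.
Conversely, each \<open>h\<close> in \<open>H\<close> is surrounded by its left coset of the smaller subgroup.\<close>

lemma openin_pspan_topology_subgroup_iff:
  assumes x: "x \<in> topspace X" and H: "subgroup H (fundamental_group X x)"
  shows "openin (pspan_topology X x) H \<longleftrightarrow> (\<exists>V. path_open_cover X x V \<and> path_spanier_subgroup X x V \<subseteq> H)"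
    (is "?lhs \<longleftrightarrow> ?rhs")
proof
  let ?G = "fundamental_group X x"
  interpret group ?G by (rule fundamental_group_is_group[OF x])
  note sg = path_spanier_subgroup_is_subgroup[OF x]
  {
    assume ?lhs
    then obtain B where B: "spanier_coset X x B" "\<one>\<^bsub>?G\<^esub> \<in> B" "B \<subseteq> H"
      using subgroup.one_closed[OF H] unfolding openin_pspan_topology[OF x] by blast
    obtain V where V: "path_open_cover X x V" and "B = \<one>\<^bsub>?G\<^esub> <#\<^bsub>?G\<^esub> path_spanier_subgroup X x V"
      using spanier_coset_recentre[OF x B(1,2)] .
    then have "B = path_spanier_subgroup X x V"
      using lcos_mult_one[OF subgroup.subset[OF sg]] by simp
    with V B(3) show ?rhs by blast
  next
    assume ?rhs
    then obtain V where V: "path_open_cover X x V" "path_spanier_subgroup X x V \<subseteq> H" by blast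
    show ?lhs
      unfolding openin_pspan_topology[OF x]
    proof
      fix h assume h: "h \<in> H"
      have hc: "h \<in> carrier ?G" using subgroup.mem_carrier[OF H h] .
      have "h <#\<^bsub>?G\<^esub> path_spanier_subgroup X x V \<subseteq> H"
        using V(2) subgroup.m_closed[OF H h] unfolding l_coset_def by blast
      then show "\<exists>B. spanier_coset X x B \<and> h \<in> B \<and> B \<subseteq> H"
        using spanier_cosetI[OF hc V(1)] mem_own_spanier_coset[OF x hc] by blast
    qed
  }
qed

section \<open>Semicovering subgroups are open\<close>

lemma fundamental_group_map_loop_class:
  assumes p: "continuous_map E X p" and f: "f \<in> loops_at E e"
  shows "fundamental_group_map X (p e) p (loop_class E e f) = loop_class X (p e) (p \<circ> f)"
proof -
  have pf: "p \<circ> f \<in> loops_at X (p e)"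
    using f pathin_compose[OF _ p] by (simp add: loops_at_def)
  have "loop_class X (p e) (p \<circ> g) = loop_class X (p e) (p \<circ> f)" if "g \<in> loop_class E e f" for g
    using that path_homotopic_compose[OF _ p]
    by (intro loop_class_eqI[OF pf, symmetric]) (simp add: loop_class_eq_path_homotopic[OF f])
  then have "(\<Union>g\<in>loop_class E e f. loop_class X (p e) (p \<circ> g)) =
      (\<Union>g\<in>loop_class E e f. loop_class X (p e) (p \<circ> f))"
    by (intro SUP_cong refl)
  then show ?thesis
    using loop_class_mem[OF f] unfolding fundamental_group_map_def by auto
qed

lemma unique_path_liftingE:
  assumes "unique_path_lifting E X p" "pathin X f" "e \<in> topspace E" "p e = f 0"
  obtains g where "pathin E g" "g 0 = e" "\<And>t. t \<in> {0..1} \<Longrightarrow> p (g t) = f t"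
proof -
  have "\<exists>!g. g \<in> extensional {0..1} \<and> pathin E g \<and> g 0 = e \<and> (\<forall>t\<in>{0..1}. p (g t) = f t)"
    using assms unfolding unique_path_lifting_def by simp
  then show thesis using that by blast
qed

text \<open>A local homeomorphism has continuous local sections through every point.\<close>

lemma local_homeomorphismE:
  assumes "local_homeomorphism E X p" "e \<in> topspace E"
  obtains U q where "openin X U" "p e \<in> U" "continuous_map (subtopology X U) E q"
    "\<And>y. y \<in> U \<Longrightarrow> p (q y) = y" "q (p e) = e"
proof -
  obtain W where W: "openin E W" "e \<in> W" "openin X (p ` W)"
    "homeomorphic_map (subtopology E W) (subtopology X (p ` W)) p"
    using assms unfolding local_homeomorphism_def by blast
  then obtain q where q: "homeomorphic_maps (subtopology E W) (subtopology X (p ` W)) p q"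
    using homeomorphic_map_maps by blast
  have top: "topspace (subtopology E W) = W" "topspace (subtopology X (p ` W)) = p ` W"
    using openin_subset[OF W(1)] openin_subset[OF W(3)] by auto
  show thesis
  proof
    show "openin X (p ` W)" "p e \<in> p ` W" using W by auto
    show "continuous_map (subtopology X (p ` W)) E q"
      using q unfolding homeomorphic_maps_def by (auto intro: continuous_map_into_fulltopology)
    show "p (q y) = y" if "y \<in> p ` W" for y
      using q that unfolding homeomorphic_maps_def top by blast
    show "q (p e) = e"
      using q W(2) unfolding homeomorphic_maps_def top by blast
  qed
qed

text \<open>The path \<open>\<alpha>\<close> is lifted by path lifting, the small loop by a local
section, and the join of the lifts is a loop over the conjugate.\<close>

lemma small_conjugates_lift:
  assumes p: "semicovering_map E X p" and e: "e \<in> topspace E"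
    and \<alpha>: "pathin X \<alpha>" "\<alpha> 0 = p e"
  obtains U where "openin X U" "\<alpha> 1 \<in> U"
    "\<And>\<beta>. \<beta> \<in> loops_at X (\<alpha> 1) \<Longrightarrow> \<beta> ` {0..1} \<subseteq> U \<Longrightarrow>
      loop_class X (p e) (conjugate_loop (\<alpha>, \<beta>)) \<in>
        fundamental_group_map X (p e) p ` carrier (fundamental_group E e)"
proof -
  have cont: "continuous_map E X p" and lh: "local_homeomorphism E X p" and upl: "unique_path_lifting E X p"
    using p by (auto simp: semicovering_map_def)
  obtain g where g: "pathin E g" "g 0 = e" and pg: "\<And>t. t \<in> {0..1} \<Longrightarrow> p (g t) = \<alpha> t"
    by (rule unique_path_liftingE[OF upl \<alpha>(1) e \<alpha>(2)[symmetric]]) (rule that)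
  have g1: "g 1 \<in> topspace E" "p (g 1) = \<alpha> 1"
    using pathin_in_topspace[OF g(1), of 1] pg[of 1] by auto
  obtain U q where U: "openin X U" "p (g 1) \<in> U" and q: "continuous_map (subtopology X U) E q"
    and pq: "\<And>y. y \<in> U \<Longrightarrow> p (q y) = y" and q1: "q (p (g 1)) = g 1"
    by (rule local_homeomorphismE[OF lh g1(1)]) (rule that)
  show thesis
  proof
    show "openin X U" "\<alpha> 1 \<in> U" using U g1 by auto
    fix \<beta> assume \<beta>: "\<beta> \<in> loops_at X (\<alpha> 1)" and sub: "\<beta> ` {0..1} \<subseteq> U"
    let ?\<gamma> = "g \<cdot>\<^sub>p (q \<circ> \<beta>) \<cdot>\<^sub>p path_rev g"
    have "pathin (subtopology X U) \<beta>"
      using \<beta> sub by (auto simp: loops_at_def pathin_subtopology)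
    then have q\<beta>: "pathin E (q \<circ> \<beta>)" using q by (rule pathin_compose)
    have ends: "(q \<circ> \<beta>) 0 = g 1" "(q \<circ> \<beta>) 1 = g 1"
      using \<beta> q1 g1(2) by (auto simp: loops_at_def)
    have \<gamma>: "?\<gamma> \<in> loops_at E e"
      using g q\<beta> ends by (simp add: loops_at_def pathin_join pathin_rev)
    have "(p \<circ> ?\<gamma>) t = conjugate_loop (\<alpha>, \<beta>) t" if "t \<in> {0..1}" for t
      using that sub by (auto simp: conjugate_loop_def path_join_def path_rev_def pg pq image_subset_iff)
    then have "path_homotopic X (p \<circ> ?\<gamma>) (conjugate_loop (\<alpha>, \<beta>))"
      using \<gamma> cont by (intro path_homotopic_eq_on) (auto simp: loops_at_def intro: pathin_compose)
    moreover have "p \<circ> ?\<gamma> \<in> loops_at X (p e)"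
      using \<gamma> pathin_compose[OF _ cont] by (simp add: loops_at_def)
    ultimately have "loop_class X (p e) (conjugate_loop (\<alpha>, \<beta>)) = fundamental_group_map X (p e) p (loop_class E e ?\<gamma>)"
      by (simp add: fundamental_group_map_loop_class[OF cont \<gamma>] loop_class_eqI)
    then show "loop_class X (p e) (conjugate_loop (\<alpha>, \<beta>)) \<in>
        fundamental_group_map X (p e) p ` carrier (fundamental_group E e)"
      using loop_class_closed[OF \<gamma>] by (rule image_eqI)
  qed
qed

lemma semicovering_subgroup_imp_openin:
  assumes x: "x \<in> topspace X" and H: "subgroup H (fundamental_group X x)"
    and semi: "semicovering_subgroup TYPE('b) X x H"
  shows "openin (pspan_topology X x) H"
proof -
  obtain E :: "'b topology" and p e where p: "semicovering_map E X p" and e: "e \<in> topspace E" and pe: "p e = x"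
    and H_eq: "H = fundamental_group_map X x p ` carrier (fundamental_group E e)"
    using semi unfolding semicovering_subgroup_def by blast
  have "\<forall>\<alpha>\<in>paths_from X x. \<exists>U. openin X U \<and> \<alpha> 1 \<in> U \<and>
      (\<forall>\<beta>\<in>loops_at X (\<alpha> 1). \<beta> ` {0..1} \<subseteq> U \<longrightarrow> loop_class X x (conjugate_loop (\<alpha>, \<beta>)) \<in> H)"
  proof
    fix \<alpha> assume "\<alpha> \<in> paths_from X x"
    then have \<alpha>: "pathin X \<alpha>" "\<alpha> 0 = p e" by (auto simp: paths_from_def pe)
    obtain U where U: "openin X U" "\<alpha> 1 \<in> U"
      and lift: "\<And>\<beta>. \<beta> \<in> loops_at X (\<alpha> 1) \<Longrightarrow> \<beta> ` {0..1} \<subseteq> U \<Longrightarrow>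
        loop_class X (p e) (conjugate_loop (\<alpha>, \<beta>)) \<in>
          fundamental_group_map X (p e) p ` carrier (fundamental_group E e)"
      by (rule small_conjugates_lift[OF p e \<alpha>]) (rule that)
    show "\<exists>U. openin X U \<and> \<alpha> 1 \<in> U \<and>
      (\<forall>\<beta>\<in>loops_at X (\<alpha> 1). \<beta> ` {0..1} \<subseteq> U \<longrightarrow> loop_class X x (conjugate_loop (\<alpha>, \<beta>)) \<in> H)"
    proof (intro exI conjI ballI impI)
      show "loop_class X x (conjugate_loop (\<alpha>, \<beta>)) \<in> H"
        if "\<beta> \<in> loops_at X (\<alpha> 1)" "\<beta> ` {0..1} \<subseteq> U" for \<beta>
        using lift[OF that] unfolding H_eq pe .
    qed (use U in auto)
  qed
  then obtain V where V: "\<forall>\<alpha>\<in>paths_from X x. openin X (V \<alpha>) \<and> \<alpha> 1 \<in> V \<alpha> \<and>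
      (\<forall>\<beta>\<in>loops_at X (\<alpha> 1). \<beta> ` {0..1} \<subseteq> V \<alpha> \<longrightarrow> loop_class X x (conjugate_loop (\<alpha>, \<beta>)) \<in> H)"
    by (rule bchoice[THEN exE])
  have "path_open_cover X x V" using V by (simp add: path_open_cover_def)
  moreover have "path_spanier_subgroup X x V \<subseteq> H"
    using V by (intro path_spanier_subgroup_subset[OF x H]) (auto simp: spanier_pair_def)
  ultimately show ?thesis
    unfolding openin_pspan_topology_subgroup_iff[OF x H] by blast
qed

section \<open>The space of path classes\<close>

text \<open>The conditions on an equivalence relation on the paths of \<open>X\<close> under which the classes form a
semicovering. \<open>R_join\<close> makes continuing a path an operation on classes, and \<open>R_small\<close> says that
sufficiently small loops at the end of a path do not change its class; the set in which they are small
may depend on the path, which is the difference to covering spaces.\<close>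

locale path_congruence =
  fixes X :: "'a topology" and R :: "(real \<Rightarrow> 'a) \<Rightarrow> (real \<Rightarrow> 'a) \<Rightarrow> bool"
  assumes lpc: "locally_path_connected_space X"
    and R_pathin: "R \<alpha> \<beta> \<Longrightarrow> pathin X \<alpha>"
    and R_end: "R \<alpha> \<beta> \<Longrightarrow> \<alpha> 1 = \<beta> 1"
    and R_sym: "R \<alpha> \<beta> \<Longrightarrow> R \<beta> \<alpha>"
    and R_trans [trans]: "R \<alpha> \<beta> \<Longrightarrow> R \<beta> \<gamma> \<Longrightarrow> R \<alpha> \<gamma>"
    and R_homotopic: "path_homotopic X \<alpha> \<beta> \<Longrightarrow> R \<alpha> \<beta>"
    and R_join: "R \<alpha> \<beta> \<Longrightarrow> pathin X \<gamma> \<Longrightarrow> \<gamma> 0 = \<alpha> 1 \<Longrightarrow> R (\<alpha> \<cdot>\<^sub>p \<gamma>) (\<beta> \<cdot>\<^sub>p \<gamma>)"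
    and R_small: "pathin X \<alpha> \<Longrightarrow> \<exists>U. openin X U \<and> \<alpha> 1 \<in> U \<and>
      (\<forall>\<beta>\<in>loops_at X (\<alpha> 1). \<beta> ` {0..1} \<subseteq> U \<longrightarrow> R (\<alpha> \<cdot>\<^sub>p \<beta>) \<alpha>)"
begin

definition path_class :: "(real \<Rightarrow> 'a) \<Rightarrow> (real \<Rightarrow> 'a) set"
  where "path_class \<alpha> = {\<beta>. R \<alpha> \<beta>}"

text \<open>Applied to classes, where by \<open>R_end\<close> the choice of the representative does not matter.\<close>

definition endpoint :: "(real \<Rightarrow> 'a) set \<Rightarrow> 'a"
  where "endpoint c = (SOME \<alpha>. \<alpha> \<in> c) 1"

definition paths_in :: "'a set \<Rightarrow> 'a \<Rightarrow> (real \<Rightarrow> 'a) set"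
  where "paths_in U y = {\<gamma>. pathin X \<gamma> \<and> \<gamma> 0 = y \<and> \<gamma> ` {0..1} \<subseteq> U}"

text \<open>The topology is described by all its open sets rather than by a base: \<open>W\<close> is open if with the class of
\<open>\<alpha>\<close> it contains the classes of all continuations of \<open>\<alpha>\<close> by paths in some neighbourhood of \<open>\<alpha> 1\<close>. The
neighbourhood may depend on the representative \<open>\<alpha>\<close> of the class.\<close>

definition total_space :: "(real \<Rightarrow> 'a) set topology"
  where "total_space = topology (\<lambda>W. W \<subseteq> path_class ` {\<alpha>. pathin X \<alpha>} \<and>
    (\<forall>\<alpha>. pathin X \<alpha> \<and> path_class \<alpha> \<in> W \<longrightarrow>
      (\<exists>U. openin X U \<and> \<alpha> 1 \<in> U \<and> (\<forall>\<gamma>\<in>paths_in U (\<alpha> 1). path_class (\<alpha> \<cdot>\<^sub>p \<gamma>) \<in> W))))"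

definition sheet :: "(real \<Rightarrow> 'a) \<Rightarrow> 'a set \<Rightarrow> (real \<Rightarrow> 'a) set set"
  where "sheet \<alpha> U = (\<lambda>\<gamma>. path_class (\<alpha> \<cdot>\<^sub>p \<gamma>)) ` paths_in U (\<alpha> 1)"

lemma R_refl: "pathin X \<alpha> \<Longrightarrow> R \<alpha> \<alpha>"
  by (intro R_homotopic path_homotopic_refl)

lemma path_class_eq_iff: "pathin X \<alpha> \<Longrightarrow> path_class \<alpha> = path_class \<beta> \<longleftrightarrow> R \<alpha> \<beta>"
proof
  assume "pathin X \<alpha>" "path_class \<alpha> = path_class \<beta>"
  then have "\<alpha> \<in> path_class \<beta>" using R_refl by (auto simp: path_class_def)
  then show "R \<alpha> \<beta>" by (simp add: path_class_def R_sym)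
next
  assume "R \<alpha> \<beta>"
  then show "path_class \<alpha> = path_class \<beta>"
    unfolding path_class_def by (intro Collect_cong iffI) (auto intro: R_sym R_trans)
qed

lemma path_class_eqI: "R \<alpha> \<beta> \<Longrightarrow> path_class \<alpha> = path_class \<beta>"
  using path_class_eq_iff R_pathin by blast

lemma endpoint_path_class [simp]:
  assumes "pathin X \<alpha>"
  shows "endpoint (path_class \<alpha>) = \<alpha> 1"
proof -
  have "\<alpha> \<in> path_class \<alpha>" using R_refl[OF assms] by (simp add: path_class_def)
  then have "(SOME \<beta>. \<beta> \<in> path_class \<alpha>) \<in> path_class \<alpha>" by (rule someI[of "\<lambda>\<beta>. \<beta> \<in> path_class \<alpha>"])
  then have "R \<alpha> (SOME \<beta>. \<beta> \<in> path_class \<alpha>)" unfolding path_class_def by simp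
  from R_end[OF this] show ?thesis by (simp add: endpoint_def)
qed

lemma paths_inD:
  assumes "\<gamma> \<in> paths_in U y"
  shows "pathin X \<gamma>" "\<gamma> 0 = y" "\<gamma> 1 \<in> U" "y \<in> U"
  using assms by (auto simp: paths_in_def image_subset_iff)

lemma paths_in_join: "\<gamma> \<in> paths_in U y \<Longrightarrow> \<delta> \<in> paths_in U (\<gamma> 1) \<Longrightarrow> \<gamma> \<cdot>\<^sub>p \<delta> \<in> paths_in U y"
  unfolding paths_in_def using pathin_join[of X \<gamma> \<delta>] by (auto simp: image_subset_iff path_join_def)

lemma paths_in_rev: "\<gamma> \<in> paths_in U y \<Longrightarrow> path_rev \<gamma> \<in> paths_in U (\<gamma> 1)"
  unfolding paths_in_def using pathin_rev[of X \<gamma>] by (auto simp: image_subset_iff path_rev_def)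

lemma paths_in_mono: "\<gamma> \<in> paths_in U y \<Longrightarrow> U \<subseteq> V \<Longrightarrow> \<gamma> \<in> paths_in V y"
  by (auto simp: paths_in_def)

lemma const_in_paths_in: "openin X U \<Longrightarrow> y \<in> U \<Longrightarrow> (\<lambda>_. y) \<in> paths_in U y"
  using openin_subset by (auto simp: paths_in_def)

lemma join_paths_in:
  "pathin X \<alpha> \<Longrightarrow> \<gamma> \<in> paths_in U (\<alpha> 1) \<Longrightarrow> pathin X (\<alpha> \<cdot>\<^sub>p \<gamma>)"
  by (simp add: paths_in_def pathin_join)

lemma openin_total_space:
  "openin total_space W \<longleftrightarrow> W \<subseteq> path_class ` {\<alpha>. pathin X \<alpha>} \<and>
    (\<forall>\<alpha>. pathin X \<alpha> \<and> path_class \<alpha> \<in> W \<longrightarrow>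
      (\<exists>U. openin X U \<and> \<alpha> 1 \<in> U \<and> (\<forall>\<gamma>\<in>paths_in U (\<alpha> 1). path_class (\<alpha> \<cdot>\<^sub>p \<gamma>) \<in> W)))"
proof -
  let ?nbhd = "\<lambda>W \<alpha>. \<exists>U. openin X U \<and> \<alpha> 1 \<in> U \<and> (\<forall>\<gamma>\<in>paths_in U (\<alpha> 1). path_class (\<alpha> \<cdot>\<^sub>p \<gamma>) \<in> W)"
  have int: "?nbhd (S \<inter> T) \<alpha>" if S: "?nbhd S \<alpha>" and T: "?nbhd T \<alpha>" for S T \<alpha>
  proof -
    obtain U where U: "openin X U" "\<alpha> 1 \<in> U" "\<forall>\<gamma>\<in>paths_in U (\<alpha> 1). path_class (\<alpha> \<cdot>\<^sub>p \<gamma>) \<in> S" using S by blast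
    obtain V where V: "openin X V" "\<alpha> 1 \<in> V" "\<forall>\<gamma>\<in>paths_in V (\<alpha> 1). path_class (\<alpha> \<cdot>\<^sub>p \<gamma>) \<in> T" using T by blast
    show ?thesis
    proof (intro exI[of _ "U \<inter> V"] conjI ballI)
      fix \<gamma> assume "\<gamma> \<in> paths_in (U \<inter> V) (\<alpha> 1)"
      then have "\<gamma> \<in> paths_in U (\<alpha> 1)" "\<gamma> \<in> paths_in V (\<alpha> 1)" by (auto simp: paths_in_def)
      with U(3) V(3) show "path_class (\<alpha> \<cdot>\<^sub>p \<gamma>) \<in> S \<inter> T" by simp
    qed (use U V in auto)
  qed
  have mono: "?nbhd T \<alpha>" if "?nbhd S \<alpha>" "S \<subseteq> T" for S T \<alpha>
    using that by blast
  have "istopology (\<lambda>W. W \<subseteq> path_class ` {\<alpha>. pathin X \<alpha>} \<and> (\<forall>\<alpha>. pathin X \<alpha> \<and> path_class \<alpha> \<in> W \<longrightarrow> ?nbhd W \<alpha>))"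
    (is "istopology ?T")
    unfolding istopology_def
  proof (intro conjI allI impI)
    fix S T assume S: "?T S" and T: "?T T"
    show "S \<inter> T \<subseteq> path_class ` {\<alpha>. pathin X \<alpha>}" using S by blast
    fix \<alpha> assume "pathin X \<alpha> \<and> path_class \<alpha> \<in> S \<inter> T"
    then show "?nbhd (S \<inter> T) \<alpha>" using S T by (intro int) simp_all
  next
    fix K assume K: "\<forall>S\<in>K. ?T S"
    show "\<Union>K \<subseteq> path_class ` {\<alpha>. pathin X \<alpha>}" using K by blast
    fix \<alpha> assume "pathin X \<alpha> \<and> path_class \<alpha> \<in> \<Union>K"
    then obtain S where "pathin X \<alpha>" "S \<in> K" "path_class \<alpha> \<in> S" by blast
    then have "?nbhd S \<alpha>" "S \<subseteq> \<Union>K" using K by (simp, blast)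
    then show "?nbhd (\<Union>K) \<alpha>" by (rule mono)
  qed
  then show ?thesis
    unfolding total_space_def by (simp only: topology_inverse')
qed

lemma openin_total_spaceE:
  assumes "openin total_space W" "pathin X \<alpha>" "path_class \<alpha> \<in> W"
  obtains U where "openin X U" "\<alpha> 1 \<in> U" "\<And>\<gamma>. \<gamma> \<in> paths_in U (\<alpha> 1) \<Longrightarrow> path_class (\<alpha> \<cdot>\<^sub>p \<gamma>) \<in> W"
proof -
  have "\<exists>U. openin X U \<and> \<alpha> 1 \<in> U \<and> (\<forall>\<gamma>\<in>paths_in U (\<alpha> 1). path_class (\<alpha> \<cdot>\<^sub>p \<gamma>) \<in> W)"
    using assms unfolding openin_total_space by simp
  then show thesis using that by blast
qed

lemma openin_total_spaceI:
  assumes "W \<subseteq> path_class ` {\<alpha>. pathin X \<alpha>}"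
    and "\<And>\<alpha>. pathin X \<alpha> \<Longrightarrow> path_class \<alpha> \<in> W \<Longrightarrow>
      \<exists>U. openin X U \<and> \<alpha> 1 \<in> U \<and> (\<forall>\<gamma>\<in>paths_in U (\<alpha> 1). path_class (\<alpha> \<cdot>\<^sub>p \<gamma>) \<in> W)"
  shows "openin total_space W"
  using assms unfolding openin_total_space by simp

lemma topspace_total_space: "topspace total_space = path_class ` {\<alpha>. pathin X \<alpha>}"
proof (rule antisym)
  show "topspace total_space \<subseteq> path_class ` {\<alpha>. pathin X \<alpha>}"
    using openin_topspace[of total_space] unfolding openin_total_space by (rule conjunct1)
  have "openin total_space (path_class ` {\<alpha>. pathin X \<alpha>})"
  proof (rule openin_total_spaceI)
    fix \<alpha> assume \<alpha>: "pathin X \<alpha>"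
    show "\<exists>U. openin X U \<and> \<alpha> 1 \<in> U \<and> (\<forall>\<gamma>\<in>paths_in U (\<alpha> 1). path_class (\<alpha> \<cdot>\<^sub>p \<gamma>) \<in> path_class ` {\<alpha>. pathin X \<alpha>})"
      using pathin_in_topspace[OF \<alpha>, of 1] join_paths_in[OF \<alpha>]
      by (intro exI[of _ "topspace X"]) simp
  qed simp
  then show "path_class ` {\<alpha>. pathin X \<alpha>} \<subseteq> topspace total_space" by (rule openin_subset)
qed

lemma path_class_in_total_space: "pathin X \<alpha> \<Longrightarrow> path_class \<alpha> \<in> topspace total_space"
  by (simp add: topspace_total_space)

lemma total_space_cases:
  assumes "c \<in> topspace total_space"
  obtains \<alpha> where "pathin X \<alpha>" "c = path_class \<alpha>"
  using assms unfolding topspace_total_space by blast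

lemma path_class_join_assoc:
  assumes "pathin X \<alpha>" "pathin X \<gamma>" "pathin X \<delta>" "\<alpha> 1 = \<gamma> 0" "\<gamma> 1 = \<delta> 0"
  shows "path_class ((\<alpha> \<cdot>\<^sub>p \<gamma>) \<cdot>\<^sub>p \<delta>) = path_class (\<alpha> \<cdot>\<^sub>p (\<gamma> \<cdot>\<^sub>p \<delta>))"
  by (intro path_class_eqI R_homotopic path_homotopic_assoc assms)

lemma path_class_join_const: "pathin X \<alpha> \<Longrightarrow> path_class (\<alpha> \<cdot>\<^sub>p (\<lambda>_. \<alpha> 1)) = path_class \<alpha>"
  by (intro path_class_eqI R_homotopic path_homotopic_join_const)

lemma path_class_in_sheet: "pathin X \<alpha> \<Longrightarrow> openin X U \<Longrightarrow> \<alpha> 1 \<in> U \<Longrightarrow> path_class \<alpha> \<in> sheet \<alpha> U"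
  unfolding sheet_def
  by (rule image_eqI[where x = "\<lambda>_. \<alpha> 1"]) (simp_all only: path_class_join_const const_in_paths_in)

text \<open>A continuation in \<open>U\<close> of a continuation in \<open>U\<close> is again a continuation of the original path.\<close>

lemma openin_sheet:
  assumes \<alpha>: "pathin X \<alpha>" and U: "openin X U"
  shows "openin total_space (sheet \<alpha> U)"
proof (rule openin_total_spaceI)
  show "sheet \<alpha> U \<subseteq> path_class ` {\<alpha>. pathin X \<alpha>}"
    using join_paths_in[OF \<alpha>] unfolding sheet_def by blast
  fix \<delta> assume \<delta>: "pathin X \<delta>" and "path_class \<delta> \<in> sheet \<alpha> U"
  then obtain \<gamma> where \<gamma>: "\<gamma> \<in> paths_in U (\<alpha> 1)" and "path_class \<delta> = path_class (\<alpha> \<cdot>\<^sub>p \<gamma>)"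
    unfolding sheet_def by blast
  then have R: "R \<delta> (\<alpha> \<cdot>\<^sub>p \<gamma>)" using \<delta> by (simp add: path_class_eq_iff)
  then have \<delta>1: "\<delta> 1 = \<gamma> 1" using R_end[OF R] by simp
  show "\<exists>V. openin X V \<and> \<delta> 1 \<in> V \<and> (\<forall>\<eta>\<in>paths_in V (\<delta> 1). path_class (\<delta> \<cdot>\<^sub>p \<eta>) \<in> sheet \<alpha> U)"
  proof (intro exI[of _ U] conjI ballI U)
    show "\<delta> 1 \<in> U" using \<delta>1 paths_inD(3)[OF \<gamma>] by simp
    fix \<eta> assume \<eta>: "\<eta> \<in> paths_in U (\<delta> 1)"
    have "path_class (\<delta> \<cdot>\<^sub>p \<eta>) = path_class ((\<alpha> \<cdot>\<^sub>p \<gamma>) \<cdot>\<^sub>p \<eta>)"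
      using R paths_inD[OF \<eta>] by (intro path_class_eqI R_join) simp_all
    also have "\<dots> = path_class (\<alpha> \<cdot>\<^sub>p (\<gamma> \<cdot>\<^sub>p \<eta>))"
      using \<alpha> paths_inD[OF \<gamma>] paths_inD[OF \<eta>] \<delta>1 by (intro path_class_join_assoc) simp_all
    also have "\<dots> \<in> sheet \<alpha> U"
      unfolding sheet_def using paths_in_join[OF \<gamma>, of \<eta>] \<eta> \<delta>1 by simp
    finally show "path_class (\<delta> \<cdot>\<^sub>p \<eta>) \<in> sheet \<alpha> U" .
  qed
qed

lemma continuous_map_endpoint: "continuous_map total_space X endpoint"
  unfolding continuous_map_def
proof (intro conjI allI impI)
  show "endpoint \<in> topspace total_space \<rightarrow> topspace X"
    using pathin_in_topspace[of X _ 1] by (auto simp: topspace_total_space)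
  fix U assume U: "openin X U"
  show "openin total_space {c \<in> topspace total_space. endpoint c \<in> U}"
  proof (rule openin_total_spaceI)
    fix \<alpha> assume \<alpha>: "pathin X \<alpha>" and "path_class \<alpha> \<in> {c \<in> topspace total_space. endpoint c \<in> U}"
    then have "\<alpha> 1 \<in> U" by simp
    moreover have "path_class (\<alpha> \<cdot>\<^sub>p \<gamma>) \<in> {c \<in> topspace total_space. endpoint c \<in> U}" if "\<gamma> \<in> paths_in U (\<alpha> 1)" for \<gamma>
      using join_paths_in[OF \<alpha> that] paths_inD(3)[OF that] by (simp add: path_class_in_total_space)
    ultimately show "\<exists>V. openin X V \<and> \<alpha> 1 \<in> V \<and>
        (\<forall>\<gamma>\<in>paths_in V (\<alpha> 1). path_class (\<alpha> \<cdot>\<^sub>p \<gamma>) \<in> {c \<in> topspace total_space. endpoint c \<in> U})"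
      using U by (intro exI[of _ U]) simp
  qed (auto simp: topspace_total_space)
qed

lemma path_connected_nbhd:
  assumes "openin X U" "y \<in> U"
  obtains V where "openin X V" "y \<in> V" "V \<subseteq> U" "\<And>z. z \<in> V \<Longrightarrow> \<exists>\<gamma>\<in>paths_in V y. \<gamma> 1 = z"
proof -
  obtain V where V: "openin X V" "path_connectedin X V" "y \<in> V" "V \<subseteq> U"
    using lpc assms unfolding locally_path_connected_space by blast
  have "\<exists>\<gamma>\<in>paths_in V y. \<gamma> 1 = z" if z: "z \<in> V" for z
  proof -
    obtain \<gamma> where "pathin X \<gamma>" "\<gamma> \<in> {0..1} \<rightarrow> V" "\<gamma> 0 = y" "\<gamma> 1 = z"
      using V(2,3) z unfolding path_connectedin by blast
    then show ?thesis by (intro bexI[of _ \<gamma>]) (auto simp: paths_in_def)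
  qed
  with V show thesis by (intro that[of V])
qed

text \<open>By local path connectedness every point near the end of \<open>\<alpha>\<close> is reached by a short continuation of \<open>\<alpha>\<close>.\<close>

lemma open_map_endpoint: "open_map total_space X endpoint"
  unfolding open_map_def
proof (intro allI impI)
  fix W assume W: "openin total_space W"
  show "openin X (endpoint ` W)"
  proof (subst openin_subopen, intro ballI)
    fix y assume "y \<in> endpoint ` W"
    then obtain \<alpha> where \<alpha>: "pathin X \<alpha>" "path_class \<alpha> \<in> W" "y = \<alpha> 1"
      using W unfolding openin_total_space by force
    obtain U where U: "openin X U" "\<alpha> 1 \<in> U" and W_closed: "\<And>\<gamma>. \<gamma> \<in> paths_in U (\<alpha> 1) \<Longrightarrow> path_class (\<alpha> \<cdot>\<^sub>p \<gamma>) \<in> W"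
      by (rule openin_total_spaceE[OF W \<alpha>(1,2)]) (rule that)
    obtain V where V: "openin X V" "\<alpha> 1 \<in> V" "V \<subseteq> U" and reach: "\<And>z. z \<in> V \<Longrightarrow> \<exists>\<gamma>\<in>paths_in V (\<alpha> 1). \<gamma> 1 = z"
      by (rule path_connected_nbhd[OF U]) (rule that)
    have "z \<in> endpoint ` W" if z: "z \<in> V" for z
    proof -
      obtain \<gamma> where \<gamma>: "\<gamma> \<in> paths_in V (\<alpha> 1)" "\<gamma> 1 = z" using reach[OF z] by blast
      have "path_class (\<alpha> \<cdot>\<^sub>p \<gamma>) \<in> W" by (rule W_closed[OF paths_in_mono[OF \<gamma>(1) V(3)]])
      moreover have "endpoint (path_class (\<alpha> \<cdot>\<^sub>p \<gamma>)) = z" using join_paths_in[OF \<alpha>(1) \<gamma>(1)] \<gamma>(2) by simp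
      ultimately show ?thesis by force
    qed
    then show "\<exists>T. openin X T \<and> y \<in> T \<and> T \<subseteq> endpoint ` W"
      using V \<alpha>(3) by (intro exI[of _ V]) auto
  qed
qed

text \<open>The two conditions on paths say that \<open>endpoint\<close> maps \<open>sheet \<alpha> U\<close> injectively and onto \<open>U\<close>.\<close>

definition evenly_small :: "(real \<Rightarrow> 'a) \<Rightarrow> 'a set \<Rightarrow> bool"
  where "evenly_small \<alpha> U \<longleftrightarrow> openin X U \<and> \<alpha> 1 \<in> U \<and>
    (\<forall>\<gamma>\<in>paths_in U (\<alpha> 1). \<forall>\<delta>\<in>paths_in U (\<alpha> 1). \<gamma> 1 = \<delta> 1 \<longrightarrow> path_class (\<alpha> \<cdot>\<^sub>p \<gamma>) = path_class (\<alpha> \<cdot>\<^sub>p \<delta>)) \<and>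
    (\<forall>z\<in>U. \<exists>\<gamma>\<in>paths_in U (\<alpha> 1). \<gamma> 1 = z)"

text \<open>If \<open>\<gamma>\<close> and \<open>\<delta>\<close> end at the same point, then \<open>\<gamma>\<close> followed by the reverse of \<open>\<delta>\<close> is a loop to which \<open>R_small\<close>
applies. Path connectedness of \<open>V\<close> provides the second half of the property.\<close>

lemma evenly_small_exists:
  assumes \<alpha>: "pathin X \<alpha>"
  obtains V where "evenly_small \<alpha> V"
proof -
  obtain U where U: "openin X U" "\<alpha> 1 \<in> U"
    and small: "\<And>\<beta>. \<beta> \<in> loops_at X (\<alpha> 1) \<Longrightarrow> \<beta> ` {0..1} \<subseteq> U \<Longrightarrow> R (\<alpha> \<cdot>\<^sub>p \<beta>) \<alpha>"
    using R_small[OF \<alpha>] by blast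
  obtain V where V: "openin X V" "\<alpha> 1 \<in> V" "V \<subseteq> U" and reach: "\<And>z. z \<in> V \<Longrightarrow> \<exists>\<gamma>\<in>paths_in V (\<alpha> 1). \<gamma> 1 = z"
    by (rule path_connected_nbhd[OF U]) (rule that)
  have "path_class (\<alpha> \<cdot>\<^sub>p \<gamma>) = path_class (\<alpha> \<cdot>\<^sub>p \<delta>)"
    if \<gamma>: "\<gamma> \<in> paths_in V (\<alpha> 1)" and \<delta>: "\<delta> \<in> paths_in V (\<alpha> 1)" and eq: "\<gamma> 1 = \<delta> 1" for \<gamma> \<delta>
  proof -
    let ?\<beta> = "\<gamma> \<cdot>\<^sub>p path_rev \<delta>"
    have \<beta>: "?\<beta> \<in> paths_in V (\<alpha> 1)"
      using paths_in_join[OF \<gamma>] paths_in_rev[OF \<delta>] eq by simp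
    have "R (\<alpha> \<cdot>\<^sub>p ?\<beta>) \<alpha>"
      using paths_in_mono[OF \<beta> V(3)] paths_inD(2)[OF \<gamma>] paths_inD(2)[OF \<delta>]
      by (intro small) (simp_all add: paths_in_def loops_at_def)
    then have "R ((\<alpha> \<cdot>\<^sub>p ?\<beta>) \<cdot>\<^sub>p \<delta>) (\<alpha> \<cdot>\<^sub>p \<delta>)"
      using paths_inD[OF \<delta>] by (intro R_join) simp_all
    moreover have "R (\<alpha> \<cdot>\<^sub>p \<gamma>) ((\<alpha> \<cdot>\<^sub>p ?\<beta>) \<cdot>\<^sub>p \<delta>)"
      using \<alpha> paths_inD[OF \<gamma>] paths_inD[OF \<delta>] eq
      by (intro R_homotopic path_homotopic_join_rev_cancel) simp_all
    ultimately show ?thesis by (intro path_class_eqI) (rule R_trans)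
  qed
  then have "evenly_small \<alpha> V"
    unfolding evenly_small_def using V(1,2) reach by blast
  then show thesis by (rule that)
qed

lemma endpoint_image_sheet:
  assumes \<alpha>: "pathin X \<alpha>" and U: "evenly_small \<alpha> U"
  shows "endpoint ` sheet \<alpha> U = U"
proof -
  have "endpoint ` sheet \<alpha> U = (\<lambda>\<gamma>. \<gamma> 1) ` paths_in U (\<alpha> 1)"
    unfolding sheet_def image_image using join_paths_in[OF \<alpha>] by (intro image_cong) simp_all
  also have "\<dots> = U"
  proof (intro equalityI subsetI)
    fix z assume "z \<in> U"
    then obtain \<gamma> where "\<gamma> \<in> paths_in U (\<alpha> 1)" "\<gamma> 1 = z"
      using U unfolding evenly_small_def by blast
    then show "z \<in> (\<lambda>\<gamma>. \<gamma> 1) ` paths_in U (\<alpha> 1)" by (intro image_eqI) simp_all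
  qed (use paths_inD(3) in blast)
  finally show ?thesis .
qed

lemma sheet_unique:
  assumes \<alpha>: "pathin X \<alpha>" and U: "evenly_small \<alpha> U" and c: "c \<in> sheet \<alpha> U"
    and \<gamma>: "\<gamma> \<in> paths_in U (\<alpha> 1)" "\<gamma> 1 = endpoint c"
  shows "c = path_class (\<alpha> \<cdot>\<^sub>p \<gamma>)"
proof -
  obtain \<delta> where \<delta>: "\<delta> \<in> paths_in U (\<alpha> 1)" and c: "c = path_class (\<alpha> \<cdot>\<^sub>p \<delta>)"
    using c unfolding sheet_def by blast
  have "\<delta> 1 = \<gamma> 1" using \<gamma>(2) join_paths_in[OF \<alpha> \<delta>] by (simp add: c)
  with U \<gamma>(1) \<delta> show ?thesis unfolding c evenly_small_def by blast
qed

lemma local_homeomorphism_endpoint: "local_homeomorphism total_space X endpoint"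
  unfolding local_homeomorphism_def
proof
  fix c assume "c \<in> topspace total_space"
  then obtain \<alpha> where \<alpha>: "pathin X \<alpha>" and c: "c = path_class \<alpha>" by (rule total_space_cases)
  obtain U where U: "evenly_small \<alpha> U" using evenly_small_exists[OF \<alpha>] .
  then have oU: "openin X U" and U1: "\<alpha> 1 \<in> U" by (simp_all add: evenly_small_def)
  let ?W = "sheet \<alpha> U"
  have oW: "openin total_space ?W" by (rule openin_sheet[OF \<alpha> oU])
  have pW: "endpoint ` ?W = U" by (rule endpoint_image_sheet[OF \<alpha> U])
  have topW: "topspace (subtopology total_space ?W) = ?W"
    using openin_subset[OF oW] by (simp add: Int_absorb1)
  have topU: "topspace (subtopology X U) = U"
    using openin_subset[OF oU] by (simp add: Int_absorb1)
  have into: "endpoint \<in> topspace (subtopology total_space ?W) \<rightarrow> U"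
    unfolding topW by (rule Pi_I) (use imageI[of _ ?W endpoint] in \<open>simp only: pW\<close>)
  have "homeomorphic_map (subtopology total_space ?W) (subtopology X U) endpoint"
  proof (rule bijective_open_imp_homeomorphic_map)
    show "continuous_map (subtopology total_space ?W) (subtopology X U) endpoint"
      by (intro continuous_map_into_subtopology continuous_map_from_subtopology continuous_map_endpoint into)
    show "open_map (subtopology total_space ?W) (subtopology X U) endpoint"
      by (intro open_map_into_subtopology open_map_from_subtopology open_map_endpoint oW into)
    show "endpoint ` topspace (subtopology total_space ?W) = topspace (subtopology X U)"
      by (simp only: topW topU pW)
    show "inj_on endpoint (topspace (subtopology total_space ?W))"
      unfolding topW
    proof (rule inj_onI)
      fix a b assume a: "a \<in> ?W" and b: "b \<in> ?W" and eq: "endpoint a = endpoint b"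
      have "endpoint a \<in> U" using imageI[OF a, of endpoint] unfolding pW .
      then obtain \<gamma> where \<gamma>: "\<gamma> \<in> paths_in U (\<alpha> 1)" "\<gamma> 1 = endpoint a"
        using U unfolding evenly_small_def by blast
      show "a = b"
        using sheet_unique[OF \<alpha> U a \<gamma>] sheet_unique[OF \<alpha> U b \<gamma>(1)] \<gamma>(2) eq by simp
    qed
  qed
  then show "\<exists>W. openin total_space W \<and> c \<in> W \<and> openin X (endpoint ` W) \<and>
      homeomorphic_map (subtopology total_space W) (subtopology X (endpoint ` W)) endpoint"
    unfolding c using oW oU path_class_in_sheet[OF \<alpha> oU U1] by (intro exI[of _ ?W]) (simp only: pW simp_thms)
qed

section \<open>Lifting paths to path classes\<close>

lemma short_segment_in_paths_in:
  assumes f: "pathin X f" and t: "t \<in> {0..1}" and U: "openin X U" "f t \<in> U"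
  obtains e where "e > 0" "\<And>s. s \<in> {0..1} \<Longrightarrow> dist t s < e \<Longrightarrow> path_segment f t s \<in> paths_in U (f t)"
proof -
  have "openin (top_of_set {0..1}) {s \<in> topspace (top_of_set {0..1}). f s \<in> U}"
    using f U(1) unfolding pathin_def by (rule openin_continuous_map_preimage)
  moreover have "t \<in> {s \<in> topspace (top_of_set {0..1}). f s \<in> U}"
    using t U(2) by simp
  ultimately obtain e where e: "e > 0" "ball t e \<inter> {0..1} \<subseteq> {s \<in> topspace (top_of_set {0..1}). f s \<in> U}"
    unfolding openin_contains_ball by meson
  show thesis
  proof (rule that[OF e(1)])
    fix s :: real assume s: "s \<in> {0..1}" "dist t s < e"
    have "path_segment f t s u \<in> U" if u: "u \<in> {0..1}" for u
    proof -
      have "t + (s - t) * u \<in> {min t s..max t s}" by (rule segment_point_bounds[OF u])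
      then have "t + (s - t) * u \<in> ball t e \<inter> {0..1}"
        using s t by (auto simp: dist_real_def)
      with e(2) show ?thesis unfolding path_segment_def by blast
    qed
    then show "path_segment f t s \<in> paths_in U (f t)"
      using pathin_segment[OF f t s(1)] by (simp add: paths_in_def image_subset_iff)
  qed
qed

lemma path_class_join_segments:
  assumes \<alpha>: "pathin X \<alpha>" and f: "pathin X f" and I: "r \<in> {0..1}" "s \<in> {0..1}" "t \<in> {0..1}" and r: "f r = \<alpha> 1"
  shows "path_class ((\<alpha> \<cdot>\<^sub>p path_segment f r s) \<cdot>\<^sub>p path_segment f s t) = path_class (\<alpha> \<cdot>\<^sub>p path_segment f r t)"
proof -
  note segs = pathin_segment[OF f I(1,2)] pathin_segment[OF f I(2,3)]
  have "path_class ((\<alpha> \<cdot>\<^sub>p path_segment f r s) \<cdot>\<^sub>p path_segment f s t) =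
      path_class (\<alpha> \<cdot>\<^sub>p (path_segment f r s \<cdot>\<^sub>p path_segment f s t))"
    using \<alpha> segs r by (intro path_class_join_assoc) simp_all
  also have "\<dots> = path_class (\<alpha> \<cdot>\<^sub>p path_segment f r t)"
    using r by (intro path_class_eqI R_homotopic path_homotopic_join path_homotopic_refl[OF \<alpha>]
        path_homotopic_segments[OF f I]) simp
  finally show ?thesis .
qed

lemma pathin_join_segment:
  assumes "pathin X \<alpha>" "pathin X f" "s \<in> {0..1}" "t \<in> {0..1}" "f s = \<alpha> 1"
  shows "pathin X (\<alpha> \<cdot>\<^sub>p path_segment f s t)"
  using assms by (intro pathin_join pathin_segment) simp_all

text \<open>Close to a time \<open>t\<close> the values are the continuations of the value at \<open>t\<close> by short segments of \<open>f\<close>, and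
those are in every neighbourhood of that value.\<close>

lemma pathin_total_space_lift:
  assumes \<alpha>: "pathin X \<alpha>" and f: "pathin X f" and f0: "f 0 = \<alpha> 1"
  shows "pathin total_space (\<lambda>t. path_class (\<alpha> \<cdot>\<^sub>p path_segment f 0 t))"
  unfolding pathin_def continuous_map_def
proof (intro conjI allI impI)
  let ?g = "\<lambda>t. path_class (\<alpha> \<cdot>\<^sub>p path_segment f 0 t)"
  have zero: "(0::real) \<in> {0..1}" by simp
  note seg = pathin_join_segment[OF \<alpha> f zero _ f0]
  show "?g \<in> topspace (top_of_set {0..1}) \<rightarrow> topspace total_space"
    by (rule Pi_I) (rule path_class_in_total_space, rule seg, simp)
  fix W assume W: "openin total_space W"
  show "openin (top_of_set {0..1}) {t \<in> topspace (top_of_set {0..1}). ?g t \<in> W}"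
    unfolding openin_contains_ball
  proof (intro conjI ballI)
    fix t assume "t \<in> {t \<in> topspace (top_of_set {0..1}). ?g t \<in> W}"
    then have t: "t \<in> {0..1}" "?g t \<in> W" by simp_all
    obtain U where U: "openin X U" "(\<alpha> \<cdot>\<^sub>p path_segment f 0 t) 1 \<in> U"
      and W_closed: "\<And>\<gamma>. \<gamma> \<in> paths_in U ((\<alpha> \<cdot>\<^sub>p path_segment f 0 t) 1) \<Longrightarrow>
        path_class ((\<alpha> \<cdot>\<^sub>p path_segment f 0 t) \<cdot>\<^sub>p \<gamma>) \<in> W"
      by (rule openin_total_spaceE[OF W seg[OF t(1)] t(2)]) (rule that)
    have ft: "f t \<in> U" using U(2) by simp
    obtain e where e: "e > 0" "\<And>s. s \<in> {0..1} \<Longrightarrow> dist t s < e \<Longrightarrow> path_segment f t s \<in> paths_in U (f t)"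
      by (rule short_segment_in_paths_in[OF f t(1) U(1) ft]) (rule that)
    have "?g s \<in> W" if s: "s \<in> {0..1}" "dist t s < e" for s
      using W_closed[of "path_segment f t s"] e(2)[OF s] path_class_join_segments[OF \<alpha> f zero t(1) s(1) f0] by simp
    then show "\<exists>e>0. ball t e \<inter> {0..1} \<subseteq> {t \<in> topspace (top_of_set {0..1}). ?g t \<in> W}"
      using e(1) by (intro exI[of _ e]) auto
  qed auto
qed

text \<open>Near \<open>t\<close> a lift stays in a sheet, on which its values are determined by their endpoints; the
continuations of a representative by segments of \<open>f\<close> are in the sheet and have the same endpoints.\<close>

lemma lift_locally_determined:
  assumes g: "pathin total_space g" and f: "pathin X f"
    and lift: "\<And>s. s \<in> {0..1} \<Longrightarrow> endpoint (g s) = f s" and t: "t \<in> {0..1}"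
  obtains e where "e > 0"
    "\<And>s \<alpha>. s \<in> {0..1} \<Longrightarrow> dist t s < e \<Longrightarrow> pathin X \<alpha> \<Longrightarrow> g t = path_class \<alpha> \<Longrightarrow>
      g s = path_class (\<alpha> \<cdot>\<^sub>p path_segment f t s)"
proof -
  obtain \<delta> where \<delta>: "pathin X \<delta>" and gt: "g t = path_class \<delta>"
    using pathin_in_topspace[OF g t] by (rule total_space_cases)
  have \<delta>1: "\<delta> 1 = f t" using lift[OF t] \<delta> by (simp add: gt)
  obtain U where U: "evenly_small \<delta> U" using evenly_small_exists[OF \<delta>] .
  then have oU: "openin X U" and U1: "\<delta> 1 \<in> U" by (simp_all add: evenly_small_def)
  have ft: "f t \<in> U" using U1 \<delta>1 by simp
  obtain e1 where e1: "e1 > 0" "\<And>s. s \<in> {0..1} \<Longrightarrow> dist t s < e1 \<Longrightarrow> path_segment f t s \<in> paths_in U (f t)"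
    by (rule short_segment_in_paths_in[OF f t oU ft]) (rule that)
  have "openin (top_of_set {0..1}) {s \<in> topspace (top_of_set {0..1}). g s \<in> sheet \<delta> U}"
    using g openin_sheet[OF \<delta> oU] unfolding pathin_def by (rule openin_continuous_map_preimage)
  moreover have "t \<in> {s \<in> topspace (top_of_set {0..1}). g s \<in> sheet \<delta> U}"
    using t path_class_in_sheet[OF \<delta> oU U1] by (simp add: gt)
  ultimately obtain e2 where e2: "e2 > 0"
    "ball t e2 \<inter> {0..1} \<subseteq> {s \<in> topspace (top_of_set {0..1}). g s \<in> sheet \<delta> U}"
    unfolding openin_contains_ball by meson
  show thesis
  proof (rule that[of "min e1 e2"])
    fix s \<alpha> assume s: "s \<in> {0..1}" "dist t s < min e1 e2" and \<alpha>: "pathin X \<alpha>" "g t = path_class \<alpha>"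
    have "s \<in> ball t e2 \<inter> {0..1}" using s by simp
    then have gs: "g s \<in> sheet \<delta> U" using e2(2) by blast
    have seg: "path_segment f t s \<in> paths_in U (\<delta> 1)"
      using e1(2)[OF s(1)] s(2) \<delta>1 by simp
    have "g s = path_class (\<delta> \<cdot>\<^sub>p path_segment f t s)"
      using lift[OF s(1)] by (intro sheet_unique[OF \<delta> U gs seg]) simp
    also have "\<dots> = path_class (\<alpha> \<cdot>\<^sub>p path_segment f t s)"
    proof (rule path_class_eqI, rule R_join)
      show "R \<delta> \<alpha>" using gt \<alpha>(2) by (intro iffD1[OF path_class_eq_iff[OF \<delta>]]) simp
    qed (use pathin_segment[OF f t s(1)] \<delta>1 in simp_all)
    finally show "g s = path_class (\<alpha> \<cdot>\<^sub>p path_segment f t s)" .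
  qed (use e1 e2 in simp)
qed

text \<open>The lift and the formula agree at \<open>0\<close>, and locally they agree either everywhere or nowhere, so they agree
on the whole interval. Local injectivity of \<open>endpoint\<close> would only show that the set of agreement is
open; expressing the value at \<open>r\<close> through the one at a nearby \<open>s\<close> shows that it is closed as well.\<close>

lemma lift_eq:
  assumes g: "pathin total_space g" and f: "pathin X f"
    and lift: "\<And>s. s \<in> {0..1} \<Longrightarrow> endpoint (g s) = f s"
    and \<alpha>: "pathin X \<alpha>" and g0: "g 0 = path_class \<alpha>" and t: "t \<in> {0..1}"
  shows "g t = path_class (\<alpha> \<cdot>\<^sub>p path_segment f 0 t)"
proof -
  have zero: "(0::real) \<in> {0..1}" by simp
  have f0: "f 0 = \<alpha> 1" using lift[OF zero] \<alpha> by (simp add: g0)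
  note seg = pathin_join_segment[OF \<alpha> f zero _ f0]
  let ?P = "\<lambda>s. g s = path_class (\<alpha> \<cdot>\<^sub>p path_segment f 0 s)"
  show "?P t"
  proof (rule connected_induction_simple[OF connected_Icc zero t])
    show "?P 0"
      using path_class_join_const[OF \<alpha>] by (simp add: g0 path_segment_self f0)
    fix r :: real assume r: "r \<in> {0..1}"
    obtain e where e: "e > 0"
      and near: "\<And>s \<beta>. s \<in> {0..1} \<Longrightarrow> dist r s < e \<Longrightarrow> pathin X \<beta> \<Longrightarrow> g r = path_class \<beta> \<Longrightarrow>
        g s = path_class (\<beta> \<cdot>\<^sub>p path_segment f r s)"
      by (rule lift_locally_determined[OF g f lift r]) (assumption, rule that)
    have iff: "?P s \<longleftrightarrow> ?P r" if s: "s \<in> {0..1}" "dist r s < e" for s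
    proof
      assume "?P r"
      then show "?P s"
        using near[OF s seg[OF r]] path_class_join_segments[OF \<alpha> f zero r s(1) f0] by simp
    next
      assume Ps: "?P s"
      obtain \<delta> where \<delta>: "pathin X \<delta>" and gr: "g r = path_class \<delta>"
        using pathin_in_topspace[OF g r] by (rule total_space_cases)
      have \<delta>1: "f r = \<delta> 1" using lift[OF r] \<delta> by (simp add: gr)
      have R: "R (\<delta> \<cdot>\<^sub>p path_segment f r s) (\<alpha> \<cdot>\<^sub>p path_segment f 0 s)"
        using near[OF s \<delta> gr] Ps
        by (intro iffD1[OF path_class_eq_iff[OF pathin_join_segment[OF \<delta> f r s(1) \<delta>1]]]) simp
      \<comment> \<open>Going along \<open>f\<close> from \<open>r\<close> to \<open>s\<close> and back carries the formula from \<open>s\<close> to \<open>r\<close>.\<close>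
      have "g r = path_class (\<delta> \<cdot>\<^sub>p path_segment f r r)"
        using path_class_join_const[OF \<delta>] by (simp add: gr path_segment_self \<delta>1)
      also have "\<dots> = path_class ((\<delta> \<cdot>\<^sub>p path_segment f r s) \<cdot>\<^sub>p path_segment f s r)"
        by (rule path_class_join_segments[OF \<delta> f r s(1) r \<delta>1, symmetric])
      also have "\<dots> = path_class ((\<alpha> \<cdot>\<^sub>p path_segment f 0 s) \<cdot>\<^sub>p path_segment f s r)"
        by (intro path_class_eqI R_join R pathin_segment[OF f s(1) r]) simp
      also have "\<dots> = path_class (\<alpha> \<cdot>\<^sub>p path_segment f 0 r)"
        by (rule path_class_join_segments[OF \<alpha> f zero s(1) r f0])
      finally show "?P r" .
    qed
    show "\<exists>T. openin (top_of_set {0..1}) T \<and> r \<in> T \<and> (\<forall>x\<in>T. \<forall>y\<in>T. ?P x \<longrightarrow> ?P y)"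
    proof (intro exI[of _ "{0..1} \<inter> ball r e"] conjI ballI impI)
      show "openin (top_of_set {0..1}) ({0..1} \<inter> ball r e)" by (rule openin_open_Int) simp
      show "r \<in> {0..1} \<inter> ball r e" using r e by simp
      fix x y assume x: "x \<in> {0..1} \<inter> ball r e" and y: "y \<in> {0..1} \<inter> ball r e" and "?P x"
      then have "?P r" using iff[of x] by simp
      then show "?P y" using iff[of y] y by simp
    qed
  qed
qed

lemma unique_path_lifting_endpoint: "unique_path_lifting total_space X endpoint"
  unfolding unique_path_lifting_def
proof (intro allI impI, elim conjE)
  fix f c assume f: "pathin X f" and c: "c \<in> topspace total_space" and f0: "endpoint c = f 0"
  obtain \<alpha> where \<alpha>: "pathin X \<alpha>" and c: "c = path_class \<alpha>" using c by (rule total_space_cases)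
  have f0: "f 0 = \<alpha> 1" using f0 \<alpha> by (simp add: c)
  have zero: "(0::real) \<in> {0..1}" by simp
  define g where "g = restrict (\<lambda>t. path_class (\<alpha> \<cdot>\<^sub>p path_segment f 0 t)) {0..1}"
  have g: "g t = path_class (\<alpha> \<cdot>\<^sub>p path_segment f 0 t)" if "t \<in> {0..1}" for t
    using that by (simp add: g_def)
  show "\<exists>!g. g \<in> extensional {0..1} \<and> pathin total_space g \<and> g 0 = c \<and> (\<forall>t\<in>{0..1}. endpoint (g t) = f t)"
  proof (rule ex1I[of _ g], intro conjI ballI)
    show "g \<in> extensional {0..1}" by (simp add: g_def)
    show "pathin total_space g"
      using pathin_total_space_lift[OF \<alpha> f f0] by (rule pathin_eq_on) (simp add: g)
    show "g 0 = c"
      using path_class_join_const[OF \<alpha>] by (simp add: g c path_segment_self f0)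
    show "endpoint (g t) = f t" if t: "t \<in> {0..1}" for t
      using pathin_join_segment[OF \<alpha> f zero t f0] by (simp add: g[OF t])
  next
    fix h assume h: "h \<in> extensional {0..1} \<and> pathin total_space h \<and> h 0 = c \<and> (\<forall>t\<in>{0..1}. endpoint (h t) = f t)"
    show "h = g"
    proof (rule extensionalityI[of _ "{0..1}"])
      fix t :: real assume t: "t \<in> {0..1}"
      show "h t = g t"
        unfolding g[OF t] using h c by (intro lift_eq[OF _ f _ \<alpha> _ t]) simp_all
    qed (use h g_def in simp_all)
  qed
qed

theorem semicovering_map_endpoint: "semicovering_map total_space X endpoint"
  unfolding semicovering_map_def
proof (intro conjI continuous_map_endpoint local_homeomorphism_endpoint unique_path_lifting_endpoint)
  show "endpoint ` topspace total_space = topspace X"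
  proof (intro equalityI subsetI)
    fix y assume "y \<in> topspace X"
    then have "pathin X (\<lambda>_. y)" by simp
    then have "endpoint (path_class (\<lambda>_. y)) = y" "path_class (\<lambda>_. y) \<in> topspace total_space"
      by (simp_all only: endpoint_path_class path_class_in_total_space)
    then show "y \<in> endpoint ` topspace total_space" by (metis imageI)
  next
    fix y assume "y \<in> endpoint ` topspace total_space"
    then show "y \<in> topspace X"
      using continuous_map_endpoint unfolding continuous_map_def by blast
  qed
qed

text \<open>By \<open>lift_eq\<close> the lift of a loop \<open>f\<close> from the class of the constant path ends at the class of \<open>f\<close>, so it is
closed exactly if \<open>f\<close> is related to the constant path.\<close>

lemma fundamental_group_map_endpoint_image:
  assumes y: "y \<in> topspace X"
  shows "fundamental_group_map X y endpoint ` carrier (fundamental_group total_space (path_class (\<lambda>_. y))) =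
    loop_class X y ` {f \<in> loops_at X y. R f (\<lambda>_. y)}"
proof -
  let ?c = "\<lambda>_::real. y"
  have c: "pathin X ?c" using y by simp
  then have pc: "endpoint (path_class ?c) = y" by simp
  note map_eq = fundamental_group_map_loop_class[OF continuous_map_endpoint, of _ "path_class ?c", unfolded pc]
  have full: "path_class (?c \<cdot>\<^sub>p path_segment f 0 1) = path_class f" if "f \<in> loops_at X y" for f
    using path_homotopic_const_join[of X f] that
    by (intro path_class_eqI R_homotopic) (simp add: path_segment_full loops_at_def)
  have zero: "(0::real) \<in> {0..1}" and one: "(1::real) \<in> {0..1}" by simp_all
  show ?thesis
  proof (intro equalityI subsetI)
    fix a assume "a \<in> fundamental_group_map X y endpoint ` carrier (fundamental_group total_space (path_class ?c))"
    then obtain g where g: "g \<in> loops_at total_space (path_class ?c)" and a: "a = loop_class X y (endpoint \<circ> g)"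
      unfolding carrier_fundamental_group image_image using map_eq by auto
    have gp: "pathin total_space g" and g0: "g 0 = path_class ?c" and g1: "g 1 = path_class ?c"
      using g by (simp_all add: loops_at_def)
    have f: "pathin X (endpoint \<circ> g)" by (rule pathin_compose[OF gp continuous_map_endpoint])
    then have loop: "endpoint \<circ> g \<in> loops_at X y" using g0 g1 pc by (simp add: loops_at_def)
    have "g 1 = path_class (?c \<cdot>\<^sub>p path_segment (endpoint \<circ> g) 0 1)"
      by (rule lift_eq[OF gp f _ c g0 one]) simp
    then have "path_class (endpoint \<circ> g) = path_class ?c" using full[OF loop] g1 by simp
    then have "R (endpoint \<circ> g) ?c" using path_class_eq_iff[OF f] by simp
    with loop show "a \<in> loop_class X y ` {f \<in> loops_at X y. R f ?c}"
      unfolding a by blast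
  next
    fix a assume "a \<in> loop_class X y ` {f \<in> loops_at X y. R f ?c}"
    then obtain f where loop: "f \<in> loops_at X y" and R: "R f ?c" and a: "a = loop_class X y f" by blast
    have f: "pathin X f" "f 0 = ?c 1" "f 0 = y" using loop by (simp_all add: loops_at_def)
    let ?g = "\<lambda>t. path_class (?c \<cdot>\<^sub>p path_segment f 0 t)"
    have "?g 0 = path_class ?c" using path_class_join_const[OF c] f(3) by (simp add: path_segment_self)
    moreover have "?g 1 = path_class ?c" using full[OF loop] path_class_eqI[OF R] by simp
    ultimately have g: "?g \<in> loops_at total_space (path_class ?c)"
      using pathin_total_space_lift[OF c f(1,2)] by (simp add: loops_at_def)
    have "endpoint (?g t) = f t" if "t \<in> {0..1}" for t
      using pathin_join_segment[OF c f(1) zero that f(2)] by simp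
    then have "path_homotopic X f (endpoint \<circ> ?g)"
      by (intro path_homotopic_eq_on f(1)) simp
    then have "a = fundamental_group_map X y endpoint (loop_class total_space (path_class ?c) ?g)"
      unfolding a map_eq[OF g] by (rule loop_class_eqI[OF loop])
    then show "a \<in> fundamental_group_map X y endpoint ` carrier (fundamental_group total_space (path_class ?c))"
      using loop_class_closed[OF g] by (rule image_eqI)
  qed
qed

end

section \<open>Open subgroups are semicovering subgroups\<close>

text \<open>For paths from \<open>x\<close> this is the orbit relation of \<open>H\<close>, acting on path classes by joining loops on the
left. Other starting points
are admitted so that every point of \<open>X\<close> is the end of some path; there all paths with the same ends are
identified.\<close>

definition same_coset :: "'a topology \<Rightarrow> 'a \<Rightarrow> (real \<Rightarrow> 'a) set set \<Rightarrow> (real \<Rightarrow> 'a) \<Rightarrow> (real \<Rightarrow> 'a) \<Rightarrow> bool"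
  where "same_coset X x H \<alpha> \<beta> \<longleftrightarrow> pathin X \<alpha> \<and> pathin X \<beta> \<and> \<alpha> 0 = \<beta> 0 \<and> \<alpha> 1 = \<beta> 1 \<and>
    (\<alpha> 0 = x \<longrightarrow> loop_class X x (\<alpha> \<cdot>\<^sub>p path_rev \<beta>) \<in> H)"

lemma same_cosetD:
  assumes "same_coset X x H \<alpha> \<beta>"
  shows "pathin X \<alpha>" "pathin X \<beta>" "\<beta> 0 = \<alpha> 0" "\<alpha> 1 = \<beta> 1"
    and "\<alpha> 0 = x \<Longrightarrow> loop_class X x (\<alpha> \<cdot>\<^sub>p path_rev \<beta>) \<in> H"
  using assms unfolding same_coset_def by (iprover intro: sym)+

lemma join_rev_in_loops:
  "pathin X \<alpha> \<Longrightarrow> pathin X \<beta> \<Longrightarrow> \<beta> 0 = \<alpha> 0 \<Longrightarrow> \<alpha> 1 = \<beta> 1 \<Longrightarrow> \<alpha> \<cdot>\<^sub>p path_rev \<beta> \<in> loops_at X (\<alpha> 0)"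
  by (simp add: loops_at_def pathin_join pathin_rev)

lemma path_homotopic_imp_same_coset:
  assumes x: "x \<in> topspace X" and H: "subgroup H (fundamental_group X x)" and h: "path_homotopic X \<alpha> \<beta>"
  shows "same_coset X x H \<alpha> \<beta>"
  unfolding same_coset_def
proof (intro conjI impI path_homotopic_imp_pathin[OF h])
  note ends = path_homotopic_imp_ends[OF h] and p = path_homotopic_imp_pathin[OF h]
  show "\<alpha> 0 = \<beta> 0" "\<alpha> 1 = \<beta> 1" using ends by simp_all
  assume 0: "\<alpha> 0 = x"
  have "path_homotopic X (\<alpha> \<cdot>\<^sub>p path_rev \<beta>) (\<alpha> \<cdot>\<^sub>p path_rev \<alpha>)"
    by (intro path_homotopic_join path_homotopic_refl p path_homotopic_rev path_homotopic_sym[OF h])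
      (simp add: ends)
  also have "path_homotopic X \<dots> (\<lambda>_. \<alpha> 0)" by (rule path_homotopic_join_rev[OF p(1)])
  finally have "loop_class X x (\<alpha> \<cdot>\<^sub>p path_rev \<beta>) = \<one>\<^bsub>fundamental_group X x\<^esub>"
    unfolding one_fundamental_group 0
    using join_rev_in_loops[OF p ends(1) ends(2)[symmetric]] 0 by (intro loop_class_eqI) simp_all
  then show "loop_class X x (\<alpha> \<cdot>\<^sub>p path_rev \<beta>) \<in> H" using subgroup.one_closed[OF H] by simp
qed

lemma same_coset_sym:
  assumes x: "x \<in> topspace X" and H: "subgroup H (fundamental_group X x)" and R: "same_coset X x H \<alpha> \<beta>"
  shows "same_coset X x H \<beta> \<alpha>"
proof -
  have p: "pathin X \<alpha>" "pathin X \<beta>" and ends: "\<beta> 0 = \<alpha> 0" "\<alpha> 1 = \<beta> 1"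
    and inH: "\<alpha> 0 = x \<Longrightarrow> loop_class X x (\<alpha> \<cdot>\<^sub>p path_rev \<beta>) \<in> H"
    by (fact same_cosetD[OF R])+
  have "loop_class X x (\<beta> \<cdot>\<^sub>p path_rev \<alpha>) \<in> H" if 0: "\<alpha> 0 = x"
  proof -
    have "loop_class X x (\<beta> \<cdot>\<^sub>p path_rev \<alpha>) = inv\<^bsub>fundamental_group X x\<^esub> loop_class X x (\<alpha> \<cdot>\<^sub>p path_rev \<beta>)"
      using inv_loop_class[OF x, of "\<alpha> \<cdot>\<^sub>p path_rev \<beta>"] join_rev_in_loops[OF p ends] ends 0
      by (simp add: path_rev_join)
    then show ?thesis using subgroup.m_inv_closed[OF H inH[OF 0]] by simp
  qed
  then show ?thesis using p ends by (simp add: same_coset_def)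
qed

lemma same_coset_trans:
  assumes x: "x \<in> topspace X" and H: "subgroup H (fundamental_group X x)"
    and R: "same_coset X x H \<alpha> \<beta>" and S: "same_coset X x H \<beta> \<gamma>"
  shows "same_coset X x H \<alpha> \<gamma>"
proof -
  have p: "pathin X \<alpha>" "pathin X \<beta>" "pathin X \<gamma>" and ends: "\<beta> 0 = \<alpha> 0" "\<alpha> 1 = \<beta> 1" "\<gamma> 0 = \<beta> 0" "\<beta> 1 = \<gamma> 1"
    and inH: "\<alpha> 0 = x \<Longrightarrow> loop_class X x (\<alpha> \<cdot>\<^sub>p path_rev \<beta>) \<in> H"
      "\<alpha> 0 = x \<Longrightarrow> loop_class X x (\<beta> \<cdot>\<^sub>p path_rev \<gamma>) \<in> H"
    using same_cosetD[OF R] same_cosetD[OF S] by simp_all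
  have "loop_class X x (\<alpha> \<cdot>\<^sub>p path_rev \<gamma>) \<in> H" if 0: "\<alpha> 0 = x"
  proof -
    have l: "\<alpha> \<cdot>\<^sub>p path_rev \<beta> \<in> loops_at X x" "\<beta> \<cdot>\<^sub>p path_rev \<gamma> \<in> loops_at X x"
      using join_rev_in_loops[OF p(1,2) ends(1,2)] join_rev_in_loops[OF p(2,3) ends(3,4)] ends 0 by simp_all
    have "path_homotopic X ((\<alpha> \<cdot>\<^sub>p path_rev \<beta>) \<cdot>\<^sub>p (\<beta> \<cdot>\<^sub>p path_rev \<gamma>))
        ((\<alpha> \<cdot>\<^sub>p path_rev \<beta>) \<cdot>\<^sub>p path_rev (\<gamma> \<cdot>\<^sub>p path_rev \<beta>))"
      using ends l by (simp add: path_rev_join path_homotopic_refl loops_at_join[unfolded loops_at_def] loops_at_def pathin_join)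
    also have "path_homotopic X \<dots> (\<alpha> \<cdot>\<^sub>p path_rev \<gamma>)"
      using p pathin_rev[OF p(2)] ends by (intro path_homotopic_join_rev_join) simp_all
    finally have "loop_class X x (\<alpha> \<cdot>\<^sub>p path_rev \<beta>) \<otimes>\<^bsub>fundamental_group X x\<^esub>
        loop_class X x (\<beta> \<cdot>\<^sub>p path_rev \<gamma>) = loop_class X x (\<alpha> \<cdot>\<^sub>p path_rev \<gamma>)"
      unfolding mult_loop_class[OF l] by (rule loop_class_eqI[OF loops_at_join[OF l]])
    then show ?thesis using subgroup.m_closed[OF H inH[OF 0 ]] 0 by simp
  qed
  then show ?thesis using p ends by (simp add: same_coset_def)
qed

lemma same_coset_join:
  assumes x: "x \<in> topspace X" and R: "same_coset X x H \<alpha> \<beta>" and \<gamma>: "pathin X \<gamma>" "\<gamma> 0 = \<alpha> 1"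
  shows "same_coset X x H (\<alpha> \<cdot>\<^sub>p \<gamma>) (\<beta> \<cdot>\<^sub>p \<gamma>)"
proof -
  have p: "pathin X \<alpha>" "pathin X \<beta>" and ends: "\<beta> 0 = \<alpha> 0" "\<alpha> 1 = \<beta> 1"
    and inH: "\<alpha> 0 = x \<Longrightarrow> loop_class X x (\<alpha> \<cdot>\<^sub>p path_rev \<beta>) \<in> H"
    by (fact same_cosetD[OF R])+
  have h: "path_homotopic X ((\<alpha> \<cdot>\<^sub>p \<gamma>) \<cdot>\<^sub>p path_rev (\<beta> \<cdot>\<^sub>p \<gamma>)) (\<alpha> \<cdot>\<^sub>p path_rev \<beta>)"
    using p \<gamma> ends by (intro path_homotopic_join_rev_join) simp_all
  have "loop_class X x ((\<alpha> \<cdot>\<^sub>p \<gamma>) \<cdot>\<^sub>p path_rev (\<beta> \<cdot>\<^sub>p \<gamma>)) \<in> H" if 0: "\<alpha> 0 = x"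
    using loop_class_eqI[OF _ path_homotopic_sym[OF h], of x] join_rev_in_loops[OF p ends] inH[OF 0] 0 by simp
  then show ?thesis using p \<gamma> ends by (simp add: same_coset_def pathin_join)
qed

text \<open>The path open cover is indexed by paths that are normalised outside of the unit interval, so the set
for \<open>\<alpha>\<close> is the one of its restriction, and the two generators formed with \<open>\<alpha>\<close> and with the restriction
are equal on the unit interval.\<close>

lemma same_coset_small:
  assumes x: "x \<in> topspace X" and H: "subgroup H (fundamental_group X x)"
    and V: "path_open_cover X x V" and VH: "path_spanier_subgroup X x V \<subseteq> H" and \<alpha>: "pathin X \<alpha>"
  obtains U where "openin X U" "\<alpha> 1 \<in> U"
    "\<And>\<beta>. \<beta> \<in> loops_at X (\<alpha> 1) \<Longrightarrow> \<beta> ` {0..1} \<subseteq> U \<Longrightarrow> same_coset X x H (\<alpha> \<cdot>\<^sub>p \<beta>) \<alpha>"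
proof (cases "\<alpha> 0 = x")
  case False
  show thesis
  proof (rule that[of "topspace X"])
    show "\<alpha> 1 \<in> topspace X" using pathin_in_topspace[OF \<alpha>, of 1] by simp
    show "same_coset X x H (\<alpha> \<cdot>\<^sub>p \<beta>) \<alpha>" if "\<beta> \<in> loops_at X (\<alpha> 1)" for \<beta>
      using that False \<alpha> by (simp add: same_coset_def loops_at_def pathin_join)
  qed simp
next
  case True
  let ?\<alpha> = "restrict \<alpha> {0..1}"
  have p': "pathin X ?\<alpha>" using \<alpha> by (rule pathin_eq_on) simp
  then have from_x: "?\<alpha> \<in> paths_from X x" using True by (simp add: paths_from_def)
  show thesis
  proof (rule that[of "V ?\<alpha>"])
    show "openin X (V ?\<alpha>)" "\<alpha> 1 \<in> V ?\<alpha>" using V from_x unfolding path_open_cover_def by force+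
    fix \<beta> assume \<beta>: "\<beta> \<in> loops_at X (\<alpha> 1)" and sub: "\<beta> ` {0..1} \<subseteq> V ?\<alpha>"
    have b: "pathin X \<beta>" "\<beta> 0 = \<alpha> 1" "\<beta> 1 = \<alpha> 1" using \<beta> by (simp_all add: loops_at_def)
    have q: "spanier_pair X x V (?\<alpha>, \<beta>)" using from_x \<beta> sub by (simp add: spanier_pair_def)
    have "path_homotopic X (conjugate_loop (?\<alpha>, \<beta>)) (\<alpha> \<cdot>\<^sub>p \<beta> \<cdot>\<^sub>p path_rev \<alpha>)"
      using conjugate_loop_in_loops[OF q]
      by (intro path_homotopic_eq_on) (auto simp: loops_at_def conjugate_loop_def path_join_def path_rev_def)
    also have "path_homotopic X \<dots> ((\<alpha> \<cdot>\<^sub>p \<beta>) \<cdot>\<^sub>p path_rev \<alpha>)"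
      using \<alpha> b pathin_rev[OF \<alpha>] by (intro path_homotopic_sym[OF path_homotopic_assoc]) simp_all
    finally have "loop_class X x ((\<alpha> \<cdot>\<^sub>p \<beta>) \<cdot>\<^sub>p path_rev \<alpha>) = loop_class X x (conjugate_loop (?\<alpha>, \<beta>))"
      using loop_class_eqI[OF conjugate_loop_in_loops[OF q]] by simp
    also have "\<dots> \<in> H" using conjugate_loop_in_path_spanier_subgroup[OF x q] VH by blast
    finally show "same_coset X x H (\<alpha> \<cdot>\<^sub>p \<beta>) \<alpha>"
      using \<alpha> b by (simp add: same_coset_def pathin_join)
  qed
qed

lemma openin_imp_semicovering_subgroup:
  fixes X :: "'a topology" and H :: "(real \<Rightarrow> 'a) set set"
  assumes lpc: "locally_path_connected_space X" and x: "x \<in> topspace X"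
    and H: "subgroup H (fundamental_group X x)" and op: "openin (pspan_topology X x) H"
  shows "semicovering_subgroup TYPE((real \<Rightarrow> 'a) set) X x H"
proof -
  obtain V where V: "path_open_cover X x V" "path_spanier_subgroup X x V \<subseteq> H"
    using op unfolding openin_pspan_topology_subgroup_iff[OF x H] by blast
  interpret path_congruence X "same_coset X x H"
  proof
    show "locally_path_connected_space X" by (rule lpc)
    show "pathin X \<alpha>" "\<alpha> 1 = \<beta> 1" if "same_coset X x H \<alpha> \<beta>" for \<alpha> \<beta>
      using that by (simp_all add: same_coset_def)
    show "\<exists>U. openin X U \<and> \<alpha> 1 \<in> U \<and>
        (\<forall>\<beta>\<in>loops_at X (\<alpha> 1). \<beta> ` {0..1} \<subseteq> U \<longrightarrow> same_coset X x H (\<alpha> \<cdot>\<^sub>p \<beta>) \<alpha>)"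
      if "pathin X \<alpha>" for \<alpha>
      by (rule same_coset_small[OF x H V that]) blast
  qed (fact same_coset_sym[OF x H] same_coset_trans[OF x H] path_homotopic_imp_same_coset[OF x H] same_coset_join[OF x])+
  let ?c = "\<lambda>_::real. x"
  have c: "pathin X ?c" using x by simp
  have "same_coset X x H f ?c \<longleftrightarrow> loop_class X x f \<in> H" if f: "f \<in> loops_at X x" for f
  proof -
    have "path_homotopic X (f \<cdot>\<^sub>p path_rev ?c) f"
      using path_homotopic_join_const[of X f] f by (simp add: path_rev_def loops_at_def)
    then have "loop_class X x (f \<cdot>\<^sub>p path_rev ?c) = loop_class X x f"
      using f loops_at_const[OF x] by (intro loop_class_eqI loops_at_join loops_at_rev)
    then show ?thesis using f c by (simp add: same_coset_def loops_at_def)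
  qed
  then have "{f \<in> loops_at X x. same_coset X x H f ?c} = {f \<in> loops_at X x. loop_class X x f \<in> H}"
    by (intro Collect_cong conj_cong refl)
  moreover have "loop_class X x ` {f \<in> loops_at X x. loop_class X x f \<in> H} = H"
    using subgroup.subset[OF H] unfolding carrier_fundamental_group by blast
  ultimately have "H = fundamental_group_map X x endpoint ` carrier (fundamental_group total_space (path_class ?c))"
    using fundamental_group_map_endpoint_image[OF x] by simp
  moreover have "endpoint (path_class ?c) = x" using c by simp
  ultimately show ?thesis
    unfolding semicovering_subgroup_def
    using semicovering_map_endpoint path_class_in_total_space[OF c] by blast
qed

theorem proposition3p10:
  fixes X :: "'a topology" and x0 :: 'a and H :: "(real \<Rightarrow> 'a) set set"
  assumes "locally_path_connected_space X"
    and "x0 \<in> topspace X"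
    and "subgroup H (fundamental_group X x0)"
  shows "(semicovering_subgroup TYPE((real \<Rightarrow> 'a) set) X x0 H \<longleftrightarrow> openin (pspan_topology X x0) H) \<and>
         (semicovering_subgroup TYPE('b) X x0 H \<longrightarrow> openin (pspan_topology X x0) H)"
proof (intro conjI iffI impI)
  show "semicovering_subgroup TYPE((real \<Rightarrow> 'a) set) X x0 H" if "openin (pspan_topology X x0) H"
    using that by (rule openin_imp_semicovering_subgroup[OF assms])
qed (rule semicovering_subgroup_imp_openin[OF assms(2,3)], assumption)+

end
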